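(* For every integer $k$ such that $k-1$ is a prime power, there exist infinitely many connected bipartite $k$-regular graphs $G$ with $\sqrt{k-2}-1<R(G)<\sqrt{k-1}-1$.
   Context: All graphs are simple. For a graph $G$ of order $n$ with adjacency eigenvalues $\lambda_1\geqslant\cdots\geqslant\lambda_n$, the HL-index is $R(G)=\max\{|\lambda_{\lfloor (n+1)/2\rfloor}|,\ |\lambda_{\lceil (n+1)/2\rceil}|\}$. *)

theory Defs
  imports "Jordan_Normal_Form.Char_Poly" "HOL-Library.Multiset" "HOL-Computational_Algebra.Primes"
begin

definition simple_graph :: "nat \<Rightarrow> (nat \<Rightarrow> nat \<Rightarrow> bool) \<Rightarrow> bool" where
  "simple_graph n E \<longleftrightarrow> (\<forall>u<n. \<forall>v<n. E u v \<longrightarrow> E v u) \<and> (\<forall>v<n. \<not> E v v)"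

definition regular_graph :: "nat \<Rightarrow> (nat \<Rightarrow> nat \<Rightarrow> bool) \<Rightarrow> nat \<Rightarrow> bool" where
  "regular_graph n E k \<longleftrightarrow> (\<forall>v<n. card {u. u < n \<and> E v u} = k)"

definition connected_graph :: "nat \<Rightarrow> (nat \<Rightarrow> nat \<Rightarrow> bool) \<Rightarrow> bool" where
  "connected_graph n E \<longleftrightarrow> n > 0 \<and>
     (\<forall>u<n. \<forall>v<n. (\<lambda>x y. x < n \<and> y < n \<and> E x y)\<^sup>*\<^sup>* u v)"

definition bipartite_graph :: "nat \<Rightarrow> (nat \<Rightarrow> nat \<Rightarrow> bool) \<Rightarrow> bool" where
  "bipartite_graph n E \<longleftrightarrow> (\<exists>S. \<forall>u<n. \<forall>v<n. E u v \<longrightarrow> (u \<in> S \<longleftrightarrow> v \<notin> S))"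

definition adj_matrix :: "nat \<Rightarrow> (nat \<Rightarrow> nat \<Rightarrow> bool) \<Rightarrow> real mat" where
  "adj_matrix n E = mat n n (\<lambda>(i, j). if E i j then 1 else 0)"

text \<open>Adjacency eigenvalues (with multiplicity) in non-increasing order:
  entry i-1 of the list is \<lambda>_i.\<close>
definition adj_eigenvalues :: "nat \<Rightarrow> (nat \<Rightarrow> nat \<Rightarrow> bool) \<Rightarrow> real list" where
  "adj_eigenvalues n E = rev (sorted_list_of_multiset (proots (char_poly (adj_matrix n E))))"

definition adj_eig :: "nat \<Rightarrow> (nat \<Rightarrow> nat \<Rightarrow> bool) \<Rightarrow> nat \<Rightarrow> real" where
  "adj_eig n E i = adj_eigenvalues n E ! (i - 1)"

text \<open>HL-index: max(|\<lambda>_{floor((n+1)/2)}|, |\<lambda>_{ceil((n+1)/2)}|).\<close>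
definition HL_index :: "nat \<Rightarrow> (nat \<Rightarrow> nat \<Rightarrow> bool) \<Rightarrow> real" where
  "HL_index n E = max \<bar>adj_eig n E ((n + 1) div 2)\<bar> \<bar>adj_eig n E ((n + 2) div 2)\<bar>"

definition prime_power :: "nat \<Rightarrow> bool" where
  "prime_power q \<longleftrightarrow> (\<exists>p m. prime p \<and> m \<ge> 1 \<and> q = p ^ m)"

end

theory Submission
  imports Defs
begin

text \<open>
  Write \<open>q = k - 1\<close>. Take an even number \<open>N\<close> of copies of the incidence graph of a
  projective plane of order \<open>q\<close>, delete one fixed flag from each copy and join the copies
  cyclically through the endpoints of the deleted flags. For a bipartite graph with balanced sides
  the HL-index is the least singular value of the biadjacency matrix \<open>B\<close>.

  Upper bound: on vectors that alternate in sign along the cycle, \<open>B\<close> acts as the incidence matrix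
  with the entry of the flag changed from \<open>1\<close> to \<open>-1\<close>; on the equitable partition given by the flag
  it has an eigenvalue in \<open>(0, \<surd>q - 1)\<close>.

  Lower bound: the square norm of \<open>B v\<close> is at least \<open>(q - x)\<close> times that of \<open>v\<close>, where \<open>x\<close> is the
  positive root of \<open>x\<^sup>2 (x + q\<^sup>2 + q + 1) = 4 q\<^sup>3\<close>; the terms coupling consecutive copies
  telescope around the cycle. Since \<open>x < 2 \<surd>(q - 1)\<close>, we get \<open>q - x > (\<surd>(q - 1) - 1)\<^sup>2\<close>.

  The plane comes from the field of order \<open>q\<close>, obtained as the ring generated by a primitive
  \<open>(q - 1)\<close>-th root of unity \<open>\<zeta>\<close> in the complex numbers modulo a maximal ideal containing \<open>p\<close>;
  the residues are represented by \<open>0\<close> and the powers of \<open>\<zeta>\<close>.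
\<close>

section \<open>Residue fields of cyclotomic rings\<close>

text \<open>The field \<open>R / M\<close> is never formed. Its elements are handled through
  representatives in \<open>R\<close>, and their equality is membership of a difference in
  \<open>M\<close>. Maximality of the ideal takes the form of \<open>ideal_inverse\<close>.\<close>

locale residue_field =
  fixes R M :: "'a::comm_ring_1 set"
  assumes one_closed: "1 \<in> R"
    and diff_closed: "x \<in> R \<Longrightarrow> y \<in> R \<Longrightarrow> x - y \<in> R"
    and mult_closed: "x \<in> R \<Longrightarrow> y \<in> R \<Longrightarrow> x * y \<in> R"
    and ideal_subset: "M \<subseteq> R"
    and ideal_diff: "x \<in> M \<Longrightarrow> y \<in> M \<Longrightarrow> x - y \<in> M"
    and ideal_mult: "x \<in> R \<Longrightarrow> y \<in> M \<Longrightarrow> x * y \<in> M"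
    and one_notin: "1 \<notin> M"
    and ideal_inverse: "x \<in> R \<Longrightarrow> x \<notin> M \<Longrightarrow> \<exists>y\<in>R. x * y - 1 \<in> M"
begin

lemma zero_closed: "0 \<in> R"
  using diff_closed[OF one_closed one_closed] by simp

lemma uminus_closed: "x \<in> R \<Longrightarrow> - x \<in> R"
  using diff_closed[OF zero_closed] by force

lemma add_closed: "x \<in> R \<Longrightarrow> y \<in> R \<Longrightarrow> x + y \<in> R"
  using diff_closed[of x "- y"] uminus_closed by simp

lemma power_closed: "x \<in> R \<Longrightarrow> x ^ n \<in> R"
  by (induction n) (auto intro: one_closed mult_closed)

lemma of_nat_closed: "of_nat n \<in> R"
  by (induction n) (auto intro: zero_closed one_closed add_closed)

lemma ideal_add: "x \<in> M \<Longrightarrow> y \<in> M \<Longrightarrow> x + y \<in> M"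
  using ideal_diff[of x "0 - y"] ideal_diff[of 0 y] ideal_diff[of y y] by simp

lemma ideal_zero: "x \<in> M \<Longrightarrow> 0 \<in> M"
  using ideal_diff[of x x] by simp

lemma ideal_uminus: "x \<in> M \<Longrightarrow> - x \<in> M"
  using ideal_diff[of 0 x] ideal_zero by simp

lemma ideal_sum: "0 \<in> M \<Longrightarrow> (\<And>i. i \<in> A \<Longrightarrow> f i \<in> M) \<Longrightarrow> sum f A \<in> M"
  by (induction A rule: infinite_finite_induct) (auto intro: ideal_add)

text \<open>If \<open>z\<close> inverts \<open>y\<close> modulo \<open>M\<close>, then
  \<open>x\<close> is congruent to \<open>z * (x * y)\<close>.\<close>

lemma ideal_prime:
  assumes "x \<in> R" "y \<in> R" "x * y \<in> M"
  shows "x \<in> M \<or> y \<in> M"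
proof (rule disjCI)
  assume "y \<notin> M"
  then obtain z where z: "z \<in> R" "y * z - 1 \<in> M"
    using ideal_inverse assms(2) by blast
  have "z * (x * y) - x * (y * z - 1) \<in> M"
    by (intro ideal_diff ideal_mult assms z)
  then show "x \<in> M" by (simp add: algebra_simps)
qed

lemma ideal_prime_prod:
  assumes "finite A" "\<And>i. i \<in> A \<Longrightarrow> f i \<in> R" "prod f A \<in> M"
  shows "\<exists>i\<in>A. f i \<in> M"
proof -
  have "prod f A \<in> R \<and> (prod f A \<in> M \<longrightarrow> (\<exists>i\<in>A. f i \<in> M))"
    using assms(1,2)
    by (induction A rule: finite_induct)
      (use one_closed one_notin in \<open>auto intro: mult_closed dest: ideal_prime\<close>)
  with assms(3) show ?thesis by blast
qed

text \<open>Modulo \<open>M\<close> only the two extreme terms of the binomial expansion survive: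
  \<open>p\<close> divides every other coefficient and lies in \<open>M\<close>.\<close>

lemma frobenius_add:
  assumes p: "prime p" "of_nat p \<in> M" and "x \<in> R" "y \<in> R"
  shows "(x + y) ^ p - (x ^ p + y ^ p) \<in> M"
proof -
  have p0: "p > 0" using p prime_gt_0_nat by blast
  have zM: "0 \<in> M" using ideal_zero p by blast
  have "(x + y) ^ p = (\<Sum>k\<le>p. of_nat (p choose k) * x ^ k * y ^ (p - k))"
    by (rule binomial_ring)
  also have "{..p} = insert 0 (insert p {0<..<p})" using p0 by auto
  also have "(\<Sum>k\<in>\<dots>. of_nat (p choose k) * x ^ k * y ^ (p - k))
      = y ^ p + (x ^ p + (\<Sum>k\<in>{0<..<p}. of_nat (p choose k) * x ^ k * y ^ (p - k)))"
    using p0 by simp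
  finally have "(x + y) ^ p - (x ^ p + y ^ p)
      = (\<Sum>k\<in>{0<..<p}. of_nat (p choose k) * x ^ k * y ^ (p - k))" by simp
  also have "\<dots> \<in> M"
  proof (rule ideal_sum[OF zM])
    fix k assume k: "k \<in> {0<..<p}"
    then have "p dvd (p choose k)"
      by (intro dvd_choose_prime) (use p in auto)
    then obtain c where c: "p choose k = p * c" by blast
    have "of_nat (p choose k) * x ^ k * y ^ (p - k) = (of_nat c * x ^ k * y ^ (p - k)) * of_nat p"
      by (simp add: c mult_ac)
    then show "of_nat (p choose k) * x ^ k * y ^ (p - k) \<in> M"
      using assms by (simp only:) (intro ideal_mult mult_closed power_closed of_nat_closed; simp)
  qed
  finally show ?thesis .
qed

lemma power_cong:
  assumes "x \<in> R" "y \<in> R" "x - y \<in> M"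
  shows "x ^ n - y ^ n \<in> M"
proof (induction n)
  case 0
  then show ?case using ideal_zero assms by simp
next
  case (Suc n)
  have "x ^ Suc n - y ^ Suc n = x * (x ^ n - y ^ n) + y ^ n * (x - y)"
    by (simp add: algebra_simps)
  then show ?case
    using assms Suc by (simp only:) (intro ideal_add ideal_mult power_closed; simp)
qed

lemma frobenius_power_add:
  assumes p: "prime p" "of_nat p \<in> M" and xy: "x \<in> R" "y \<in> R"
  shows "(x + y) ^ (p ^ m) - (x ^ (p ^ m) + y ^ (p ^ m)) \<in> M"
proof (induction m)
  case 0
  then show ?case using ideal_zero p by simp
next
  case (Suc m)
  let ?a = "x ^ (p ^ m)" and ?b = "y ^ (p ^ m)"
  have "((x + y) ^ (p ^ m)) ^ p - (?a + ?b) ^ p \<in> M"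
    by (intro power_cong power_closed add_closed xy Suc)
  moreover have "(?a + ?b) ^ p - (?a ^ p + ?b ^ p) \<in> M"
    by (intro frobenius_add p power_closed xy)
  ultimately have "(((x + y) ^ (p ^ m)) ^ p - (?a + ?b) ^ p) + ((?a + ?b) ^ p - (?a ^ p + ?b ^ p)) \<in> M"
    by (rule ideal_add)
  also have "(((x + y) ^ (p ^ m)) ^ p - (?a + ?b) ^ p) + ((?a + ?b) ^ p - (?a ^ p + ?b ^ p))
      = (x + y) ^ (p ^ Suc m) - (x ^ (p ^ Suc m) + y ^ (p ^ Suc m))"
    by (simp add: power_mult[symmetric] mult.commute[of p])
  finally show ?case .
qed

end

section \<open>Existence of a maximal ideal\<close>

text \<open>Zorn's lemma for the proper ideals containing \<open>p\<close>. The principal ideal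
  generated by \<open>p\<close> is one of them because \<open>p\<close> is not a unit of
  \<open>R\<close>; maximality then gives inverses modulo \<open>M\<close>.\<close>

lemma exists_residue_field:
  fixes R :: "'a::comm_ring_1 set"
  assumes one: "1 \<in> R"
    and diff: "\<And>x y. x \<in> R \<Longrightarrow> y \<in> R \<Longrightarrow> x - y \<in> R"
    and mult: "\<And>x y. x \<in> R \<Longrightarrow> y \<in> R \<Longrightarrow> x * y \<in> R"
    and p: "p \<in> R" "\<And>u. u \<in> R \<Longrightarrow> p * u \<noteq> 1"
  shows "\<exists>M. residue_field R M \<and> p \<in> M"
proof -
  have zR: "0 \<in> R" using diff[OF one one] by simp
  have add: "x + y \<in> R" if "x \<in> R" "y \<in> R" for x y
    using diff[OF that(1) diff[OF zR that(2)]] by simp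
  define C where "C = {I. p \<in> I \<and> I \<subseteq> R \<and> 1 \<notin> I \<and> (\<forall>x\<in>I. \<forall>y\<in>I. x - y \<in> I) \<and> (\<forall>x\<in>R. \<forall>y\<in>I. x * y \<in> I)}"
  have "(\<lambda>u. p * u) ` R \<in> C"
  proof -
    have "p * x - p * y \<in> (\<lambda>u. p * u) ` R" if "x \<in> R" "y \<in> R" for x y
      using diff[OF that] by (auto simp: right_diff_distrib[symmetric])
    moreover have "x * (p * y) \<in> (\<lambda>u. p * u) ` R" if "x \<in> R" "y \<in> R" for x y
      using mult[OF that] by (auto simp: mult.left_commute)
    moreover have "p \<in> (\<lambda>u. p * u) ` R" using one by force
    moreover have "1 \<notin> (\<lambda>u. p * u) ` R" using p(2) by force
    ultimately show ?thesis
      unfolding C_def using mult p(1) by auto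
  qed
  then have "C \<noteq> {}" by blast
  moreover have "\<Union>\<C> \<in> C" if "\<C> \<noteq> {}" "subset.chain C \<C>" for \<C>
  proof -
    have lin: "X \<subseteq> Y \<or> Y \<subseteq> X" if "X \<in> \<C>" "Y \<in> \<C>" for X Y
      using \<open>subset.chain C \<C>\<close> that by (auto simp: subset.chain_def)
    have sub: "\<C> \<subseteq> C" using \<open>subset.chain C \<C>\<close> by (auto simp: subset.chain_def)
    have "x - y \<in> \<Union>\<C>" if xy: "x \<in> \<Union>\<C>" "y \<in> \<Union>\<C>" for x y
    proof -
      obtain X Y where XY: "X \<in> \<C>" "Y \<in> \<C>" "x \<in> X" "y \<in> Y" using xy by blast
      then obtain Z where "Z \<in> \<C>" "x \<in> Z" "y \<in> Z" using lin by blast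
      then show ?thesis using sub unfolding C_def by blast
    qed
    then show ?thesis using sub \<open>\<C> \<noteq> {}\<close> unfolding C_def by blast
  qed
  ultimately obtain M where M: "M \<in> C" and max: "\<And>X. X \<in> C \<Longrightarrow> M \<subseteq> X \<Longrightarrow> X = M"
    using subset_Zorn_nonempty[of C] by metis
  have MD: "p \<in> M" "M \<subseteq> R" "1 \<notin> M" "\<And>x y. x \<in> M \<Longrightarrow> y \<in> M \<Longrightarrow> x - y \<in> M"
    "\<And>x y. x \<in> R \<Longrightarrow> y \<in> M \<Longrightarrow> x * y \<in> M"
    using M unfolding C_def by auto
  have inv: "\<exists>y\<in>R. x * y - 1 \<in> M" if x: "x \<in> R" "x \<notin> M" for x
  proof (rule ccontr)
    assume no: "\<not> (\<exists>y\<in>R. x * y - 1 \<in> M)"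
    \<comment> \<open>\<open>X\<close> is the ideal generated by \<open>M\<close> and
      \<open>x\<close>. It is proper, since \<open>1 = a + x * y\<close> would make \<open>y\<close>
      an inverse of \<open>x\<close> modulo \<open>M\<close>; maximality then forces
      \<open>x\<close> into \<open>M\<close>.\<close>
    define X where "X = {a + x * y | a y. a \<in> M \<and> y \<in> R}"
    have XI: "a + x * y \<in> X" if "a \<in> M" "y \<in> R" for a y using that X_def by blast
    have zM: "0 \<in> M" using MD(4)[OF MD(1) MD(1)] by simp
    have "M \<subseteq> X" using XI[OF _ zR] by auto
    have "x \<in> X" using XI[OF zM one] by simp
    have "X \<in> C"
      unfolding C_def
    proof (intro CollectI conjI ballI)
      show "p \<in> X" using \<open>M \<subseteq> X\<close> MD(1) by blast
      show "X \<subseteq> R" unfolding X_def using MD(2) mult add x(1) by auto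
      show "1 \<notin> X"
      proof
        assume "1 \<in> X"
        then obtain a y where ay: "a \<in> M" "y \<in> R" "1 = a + x * y" unfolding X_def by blast
        have "0 - a \<in> M" using MD(4)[OF zM ay(1)] .
        moreover have "0 - a = x * y - 1" by (subst ay(3)) simp
        ultimately show False using no ay(2) by auto
      qed
      show "u - v \<in> X" if uv: "u \<in> X" "v \<in> X" for u v
      proof -
        obtain a y b z where *: "a \<in> M" "y \<in> R" "u = a + x * y" "b \<in> M" "z \<in> R" "v = b + x * z"
          using uv unfolding X_def by blast
        have "u - v = (a - b) + x * (y - z)" using * by (simp add: algebra_simps)
        then show ?thesis using XI[OF MD(4)[OF *(1,4)] diff[OF *(2,5)]] by simp
      qed
      show "r * u \<in> X" if ru: "r \<in> R" "u \<in> X" for r u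
      proof -
        obtain a y where *: "a \<in> M" "y \<in> R" "u = a + x * y" using ru unfolding X_def by blast
        have "r * u = r * a + x * (r * y)" using * by (simp add: algebra_simps)
        then show ?thesis using XI[of "r * a" "r * y"] * MD(5) mult ru by simp
      qed
    qed
    then show False using max \<open>M \<subseteq> X\<close> \<open>x \<in> X\<close> x(2) by blast
  qed
  have "residue_field R M"
    by unfold_locales (use one diff mult MD inv in auto)
  then show ?thesis using MD(1) by blast
qed


section \<open>Integrality of the integer polynomials in \<open>\<zeta>\<close>\<close>

context
  fixes n :: nat and \<zeta> :: complex
  assumes n: "n > 0" and root: "\<zeta> ^ n = 1"
begin

text \<open>Horner's scheme: multiplication by \<open>\<zeta>\<close> shifts the coefficients, and
  \<open>\<zeta> ^ n = 1\<close> carries the top one round to the constant term.\<close>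

lemma adjoin_root_of_unity_coords:
  "\<exists>c::nat \<Rightarrow> int. poly (map_poly of_int f) \<zeta> = (\<Sum>i<n. of_int (c i) * \<zeta> ^ i)"
proof (induction f)
  case 0
  show ?case by (intro exI[of _ "\<lambda>_. 0"]) simp
next
  case (pCons a f)
  then obtain c :: "nat \<Rightarrow> int"
    where c: "poly (map_poly of_int f) \<zeta> = (\<Sum>i<n. of_int (c i) * \<zeta> ^ i)" by blast
  obtain m where m: "n = Suc m" using n gr0_conv_Suc by blast
  define d where "d i = (case i of 0 \<Rightarrow> a + c m | Suc j \<Rightarrow> c j)" for i
  have "(\<Sum>i<n. of_int (d i) * \<zeta> ^ i) = of_int a + of_int (c m) * \<zeta> ^ n + (\<Sum>i<m. of_int (c i) * \<zeta> ^ Suc i)"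
    by (simp only: m sum.lessThan_Suc_shift) (simp add: d_def root[unfolded m, simplified])
  also have "\<dots> = of_int a + \<zeta> * (\<Sum>i<n. of_int (c i) * \<zeta> ^ i)"
    by (simp add: m sum_distrib_left algebra_simps)
  also have "\<dots> = poly (map_poly of_int (pCons a f)) \<zeta>"
    by (simp add: c of_int_hom.map_poly_pCons_hom)
  finally show ?case by metis
qed

text \<open>Multiplication by an element acts on the spanning vector of powers of \<open>\<zeta>\<close> through an
  integer matrix, so the element is a root of a monic integer polynomial.\<close>

lemma adjoin_root_of_unity_algebraic_int:
  "algebraic_int (poly (map_poly of_int f) \<zeta>)"
proof -
  define u where "u = poly (map_poly of_int f) \<zeta>"
  have "\<exists>c::nat \<Rightarrow> int. u * \<zeta> ^ i = (\<Sum>j<n. of_int (c j) * \<zeta> ^ j)" for i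
  proof -
    have "u * \<zeta> ^ i = poly (map_poly of_int (f * monom 1 i)) \<zeta>"
      by (simp add: u_def of_int_poly_hom.hom_mult poly_monom)
    then show ?thesis using adjoin_root_of_unity_coords by simp
  qed
  then obtain c :: "nat \<Rightarrow> nat \<Rightarrow> int"
    where c: "\<And>i. u * \<zeta> ^ i = (\<Sum>j<n. of_int (c i j) * \<zeta> ^ j)" by metis
  define A where "A = mat n n (\<lambda>(i, j). c i j)"
  define B :: "complex mat" where "B = map_mat of_int A"
  have A: "A \<in> carrier_mat n n" and B: "B \<in> carrier_mat n n" by (auto simp: A_def B_def)
  have "eigenvector B (vec n (\<lambda>i. \<zeta> ^ i)) u"
    unfolding eigenvector_def
  proof (intro conjI)
    show "vec n ((^) \<zeta>) \<in> carrier_vec (dim_row B)" using B by simp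
    show "vec n ((^) \<zeta>) \<noteq> 0\<^sub>v (dim_row B)"
    proof
      assume "vec n ((^) \<zeta>) = 0\<^sub>v (dim_row B)"
      then have "vec n ((^) \<zeta>) $ 0 = 0\<^sub>v n $ 0" using B by simp
      then show False using n by simp
    qed
    show "B *\<^sub>v vec n ((^) \<zeta>) = u \<cdot>\<^sub>v vec n ((^) \<zeta>)"
      by (rule eq_vecI) (simp_all add: B_def A_def scalar_prod_def c atLeast0LessThan)
  qed
  then have "poly (char_poly B) u = 0"
    using eigenvalue_root_char_poly[OF B] by (auto simp: eigenvalue_def)
  then have "poly (map_poly of_int (char_poly A)) u = 0"
    by (simp add: B_def of_int_hom.char_poly_hom[OF A])
  moreover have "lead_coeff (char_poly A) = 1"
    using degree_monic_char_poly[OF A] by simp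
  ultimately show ?thesis
    unfolding u_def[symmetric] algebraic_int_altdef_ipoly by blast
qed

end

section \<open>A field of prime power order\<close>

text \<open>The polynomial is monic and shares no root with its derivative, whose only possible root
  is \<open>0\<close>; so it is a product of distinct linear factors.\<close>

lemma prod_minus_roots_of_unity:
  fixes x :: complex
  assumes "n > 0"
  shows "(\<Prod>z | z ^ n = 1. x - z) = x ^ n - 1"
proof -
  define f :: "complex poly" where "f = monom 1 n - 1"
  have roots: "poly f z = 0 \<longleftrightarrow> z ^ n = 1" for z
    by (simp add: f_def poly_monom)
  have deg: "degree f = n" and lead: "lead_coeff f = 1"
  proof -
    show d: "degree f = n"
      unfolding f_def using assms by (subst diff_conv_add_uminus, subst degree_add_eq_left) (auto simp: degree_monom_eq)
    show "lead_coeff f = 1" unfolding d using assms by (simp add: f_def coeff_1)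
  qed
  have "rsquarefree f"
    unfolding rsquarefree_roots
  proof (intro allI notI)
    fix a assume a: "poly f a = 0 \<and> poly (pderiv f) a = 0"
    have "pderiv f = monom (of_nat n) (n - 1)"
      by (simp add: f_def pderiv_diff pderiv_monom)
    then have "a = 0" using a assms by (auto simp: poly_monom)
    then show False using a assms by (simp add: roots zero_power)
  qed
  from complex_poly_decompose_rsquarefree[OF this]
  have "poly (\<Prod>z | z ^ n = 1. [:- z, 1:]) x = poly f x"
    by (simp only: lead smult_1_left roots)
  then show ?thesis by (simp add: poly_prod f_def poly_monom)
qed

text \<open>\<open>T\<close> is the set of complex roots of \<open>x ^ q - x\<close>, so this
  expression is the product of \<open>x - t\<close> over \<open>T\<close>. It lies in
  \<open>M\<close> for every \<open>x\<close> in \<open>R\<close>, hence primality of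
  \<open>M\<close> yields a representative of \<open>x\<close>; it is unique because the elements of
  \<open>T\<close> are incongruent modulo \<open>M\<close>.\<close>

lemma exists_residue_field_of_prime_power_order:
  assumes p: "prime p" and m: "m \<ge> 1" and q: "q = p ^ m"
  shows "\<exists>(R::complex set) M T. residue_field R M \<and> T \<subseteq> R \<and> finite T \<and> card T = q \<and>
           (\<forall>x\<in>R. \<exists>!t. t \<in> T \<and> x - t \<in> M)"
proof -
  define n where "n = q - 1"
  have q2: "q \<ge> 2" using q m prime_ge_2_nat[OF p] self_le_power[of p m] by linarith
  then have n: "n > 0" and qn: "q = Suc n" by (auto simp: n_def)
  define \<zeta> where "\<zeta> = cis (2 * pi / real n)"
  have bij: "bij_betw (\<lambda>k. \<zeta> ^ k) {..<n} {z. z ^ n = 1}"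
  proof -
    have "\<zeta> ^ k = cis (2 * pi * real k / real n)" for k
      by (simp add: \<zeta>_def Complex.DeMoivre mult_ac)
    then show ?thesis using bij_betw_roots_unity[OF n] by simp
  qed
  have root: "\<zeta> ^ n = 1" by (simp add: \<zeta>_def Complex.DeMoivre n)
  define R where "R = range (\<lambda>f::int poly. poly (map_poly of_int f) \<zeta>)"
  have RI: "poly (map_poly of_int f) \<zeta> \<in> R" for f by (simp add: R_def)
  have R1: "1 \<in> R" using RI[of 1] by simp
  have Rdiff: "x - y \<in> R" if xy: "x \<in> R" "y \<in> R" for x y
  proof -
    obtain f g where "x = poly (map_poly of_int f) \<zeta>" "y = poly (map_poly of_int g) \<zeta>"
      using xy unfolding R_def by blast
    then show ?thesis using RI[of "f - g"] by (simp add: of_int_poly_hom.hom_minus)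
  qed
  have Rmult: "x * y \<in> R" if xy: "x \<in> R" "y \<in> R" for x y
  proof -
    obtain f g where "x = poly (map_poly of_int f) \<zeta>" "y = poly (map_poly of_int g) \<zeta>"
      using xy unfolding R_def by blast
    then show ?thesis using RI[of "f * g"] by (simp add: of_int_poly_hom.hom_mult)
  qed
  have Rz: "\<zeta> \<in> R" using RI[of "[:0, 1:]"] by (simp add: map_poly_pCons)
  have Rp: "of_nat p \<in> R" using RI[of "of_nat p"] by (simp add: of_int_poly_hom.hom_of_nat)
  \<comment> \<open>\<open>p\<close> is not a unit of \<open>R\<close>: its inverse would be the
    rational number \<open>1 / p\<close>, which is not an algebraic integer.\<close>
  have pu: "of_nat p * u \<noteq> 1" if u: "u \<in> R" for u
  proof
    assume *: "of_nat p * u = 1"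
    have "p > 0" using p prime_gt_0_nat by blast
    then have u': "u = 1 / of_nat p" using * by (simp add: field_simps)
    have "algebraic_int u"
      using u adjoin_root_of_unity_algebraic_int[OF n root] unfolding R_def by blast
    moreover have "u \<in> \<rat>" by (simp add: u')
    ultimately have "u \<in> \<int>" by (rule rational_algebraic_int_is_int)
    then obtain c where "u = of_int c" by (auto elim: Ints_cases)
    then have "(of_int (int p * c) :: complex) = of_int 1" using * by simp
    then have "int p * c = 1" by (simp only: of_int_eq_iff)
    then have "int p dvd 1" by (metis dvd_triv_left)
    then show False using p by (simp add: prime_nat_iff)
  qed
  obtain M where "residue_field R M" and pM: "of_nat p \<in> M"
    using exists_residue_field[OF R1 Rdiff Rmult Rp pu] by blast
  interpret residue_field R M by fact
  have zM: "0 \<in> M" using ideal_zero pM by blast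
  have "\<zeta> ^ k \<in> R" for k by (rule power_closed) (rule Rz)
  then have rootsR: "z \<in> R" if "z ^ n = 1" for z
  proof -
    have "z \<in> (\<lambda>k. \<zeta> ^ k) ` {..<n}" using bij that by (simp add: bij_betw_def)
    then show ?thesis using \<open>\<And>k. \<zeta> ^ k \<in> R\<close> by blast
  qed
  have unit: "z \<notin> M" if z: "z ^ n = 1" for z
  proof
    assume "z \<in> M"
    then have "z ^ (n - 1) * z \<in> M" by (intro ideal_mult power_closed rootsR z)
    then show False using z n one_notin by (simp add: power_Suc2[symmetric] del: power_Suc2 power_Suc)
  qed
  \<comment> \<open>\<open>q\<close> lies in \<open>M\<close> as a multiple of \<open>p\<close>, so
    \<open>n = q - 1\<close> is congruent to \<open>-1\<close>.\<close>
  have n_notin: "of_nat n \<notin> M"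
  proof
    assume "of_nat n \<in> M"
    have "p dvd q" using m by (simp add: q dvd_power)
    then obtain c where "q = p * c" by blast
    then have "of_nat c * of_nat p - of_nat n = (1::complex)"
      using qn by (metis add_diff_cancel_right' mult.commute of_nat_Suc of_nat_mult)
    moreover have "of_nat c * of_nat p - of_nat n \<in> M"
      by (intro ideal_diff ideal_mult of_nat_closed pM \<open>of_nat n \<in> M\<close>)
    ultimately show False using one_notin by simp
  qed
  text \<open>Distinct \<open>n\<close>-th roots of unity stay distinct modulo \<open>M\<close>: the geometric sum of a
    nontrivial root is \<open>0\<close>, but it would be \<open>n\<close> modulo \<open>M\<close> for a root congruent to \<open>1\<close>.\<close>
  have one_root: "z = 1" if z: "z ^ n = 1" "z - 1 \<in> M" for z
  proof (rule ccontr)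
    assume "z \<noteq> 1"
    then have "(\<Sum>i<n. z ^ i) = 0" using geometric_sum[of z n] z(1) by simp
    then have "of_nat n = - (\<Sum>i<n. z ^ i - 1 ^ i)" by (simp add: sum_subtractf)
    also have "\<dots> \<in> M"
      by (intro ideal_uminus ideal_sum zM power_cong rootsR z one_closed)
    finally show False using n_notin by simp
  qed
  \<comment> \<open>Division by \<open>w\<close> reduces this to \<open>one_root\<close>; the
    inverse of \<open>w\<close> is again a root of unity and so lies in \<open>R\<close>.\<close>
  have distinct: "z = w" if z: "z ^ n = 1" and w: "w ^ n = 1" and zw: "z - w \<in> M" for z w
  proof -
    have "w \<noteq> 0" using w n by (auto simp: zero_power)
    have wi: "(1 / w) ^ n = 1" using w by (simp add: power_divide)
    have "(1 / w) * (z - w) \<in> M" by (intro ideal_mult rootsR wi zw)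
    then have "z / w - 1 \<in> M" using \<open>w \<noteq> 0\<close> by (simp add: field_simps)
    moreover have "(z / w) ^ n = 1" using z w by (simp add: power_divide)
    ultimately have "z / w = 1" by (rule one_root[rotated])
    then show ?thesis using \<open>w \<noteq> 0\<close> by simp
  qed
  \<comment> \<open>By the Frobenius identity \<open>?S\<close> is closed under the ring operations.
    It contains the integers and \<open>\<zeta>\<close>, for which
    \<open>\<zeta> ^ q = \<zeta>\<close>, hence all of \<open>R\<close>.\<close>
  have power_q: "x ^ q - x \<in> M" if xR: "x \<in> R" for x
  proof -
    let ?S = "{x \<in> R. x ^ q - x \<in> M}"
    have add: "x + y \<in> ?S" if xy: "x \<in> ?S" "y \<in> ?S" for x y
    proof -
      have "((x + y) ^ q - (x ^ q + y ^ q)) + ((x ^ q - x) + (y ^ q - y)) \<in> M"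
        using xy unfolding q by (intro ideal_add frobenius_power_add p pM) auto
      then show ?thesis using xy add_closed by (simp add: algebra_simps)
    qed
    have mult: "x * y \<in> ?S" if xy: "x \<in> ?S" "y \<in> ?S" for x y
    proof -
      have "x ^ q * (y ^ q - y) + y * (x ^ q - x) \<in> M"
        using xy by (intro ideal_add ideal_mult power_closed) auto
      then show ?thesis using xy mult_closed by (simp add: algebra_simps power_mult_distrib)
    qed
    have neg: "- x \<in> ?S" if x: "x \<in> ?S" for x
    proof -
      have "((x + - x) ^ q - (x ^ q + (- x) ^ q)) + (x ^ q - x) \<in> M"
        using x unfolding q by (intro ideal_add frobenius_power_add p pM uminus_closed) auto
      then have "- (- ((- x) ^ q) - x) \<in> M" using q2 by (intro ideal_uminus) (simp add: zero_power)
      then show ?thesis using x uminus_closed by (simp add: add.commute)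
    qed
    have nat: "of_nat k \<in> ?S" for k
    proof (induction k)
      case 0
      then show ?case using zM q2 zero_closed by (simp add: zero_power)
    next
      case (Suc k)
      have "1 \<in> ?S" using zM one_closed by simp
      from add[OF this Suc] show ?case by simp
    qed
    have int: "of_int k \<in> ?S" for k
      using nat neg[OF nat] by (cases k rule: int_cases2) (simp_all only: of_int_minus of_int_of_nat_eq)
    have zS: "\<zeta> \<in> ?S" using Rz zM root by (simp add: qn)
    have "poly (map_poly of_int f) \<zeta> \<in> ?S" for f
    proof (induction f)
      case 0
      then show ?case using int[of 0] by simp
    next
      case (pCons a f)
      then show ?case using add[OF int[of a] mult[OF zS pCons(2)]] by (simp add: map_poly_pCons)
    qed
    then show ?thesis using xR unfolding R_def by blast
  qed
  define T where "T = insert 0 {z::complex. z ^ n = 1}"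
  have fin: "finite {z::complex. z ^ n = 1}" and card: "card {z::complex. z ^ n = 1} = n"
    using bij_betw_finite[OF bij] bij_betw_same_card[OF bij] by auto
  have "T \<subseteq> R" using rootsR zero_closed by (auto simp: T_def)
  moreover have "finite T" using fin by (simp add: T_def)
  moreover have "card T = q" using fin card n by (simp add: T_def qn zero_power)
  moreover have "\<exists>!t. t \<in> T \<and> x - t \<in> M" if x: "x \<in> R" for x
  proof (rule ex_ex1I)
    have "x * (\<Prod>z | z ^ n = 1. x - z) = x ^ q - x"
      by (simp add: prod_minus_roots_of_unity[OF n] qn algebra_simps)
    then have "x * (\<Prod>z | z ^ n = 1. x - z) = (\<Prod>z\<in>T. x - z)"
      and "x * (\<Prod>z | z ^ n = 1. x - z) \<in> M"
      using fin n power_q[OF x] by (simp_all add: T_def zero_power)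
    then have "(\<Prod>z\<in>T. x - z) \<in> M" by simp
    then show "\<exists>t. t \<in> T \<and> x - t \<in> M"
      using ideal_prime_prod[OF \<open>finite T\<close>, of "\<lambda>z. x - z"] diff_closed[OF x] \<open>T \<subseteq> R\<close> by blast
  next
    fix s t assume st: "s \<in> T \<and> x - s \<in> M" "t \<in> T \<and> x - t \<in> M"
    then have "(x - s) - (x - t) \<in> M" using ideal_diff by blast
    then have ts: "t - s \<in> M" by simp
    show "s = t"
    \<comment> \<open>If one of them is \<open>0\<close>, both lie in \<open>M\<close>; the roots of
      unity are units and so avoid \<open>M\<close>, which leaves \<open>0\<close> for the other as
      well.\<close>
    proof (cases "s = 0 \<or> t = 0")
      case True
      then have "s \<in> M \<and> t \<in> M"
        using ts ideal_uminus[OF ts] zM by auto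
      then show ?thesis using st unit by (auto simp: T_def)
    next
      case False
      then show ?thesis using distinct[OF _ _ ts] st by (auto simp: T_def)
    qed
  qed
  ultimately show ?thesis
    by (intro exI[of _ R] exI[of _ M] exI[of _ T] conjI ballI \<open>residue_field R M\<close>)
qed

section \<open>The middle eigenvalues of a bipartite graph\<close>

text \<open>The polynomial splits over the complex numbers. For an eigenvector \<open>v\<close> of a
  root \<open>a\<close>, the Hermitian form \<open>s\<close> of the matrix at \<open>v\<close> is
  \<open>a\<close> times the squared norm \<open>r > 0\<close>, and symmetry makes \<open>s\<close>
  equal to its own conjugate; so \<open>a\<close> is real.\<close>

lemma real_symmetric_char_poly_splits:
  fixes A :: "real mat"
  assumes A: "A \<in> carrier_mat n n"
    and sym: "\<And>i j. i < n \<Longrightarrow> j < n \<Longrightarrow> A $$ (i, j) = A $$ (j, i)"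
  shows "\<exists>es. char_poly A = (\<Prod>a\<leftarrow>es. [:- a, 1:]) \<and> length es = n"
proof -
  define B :: "complex mat" where "B = map_mat of_real A"
  have B: "B \<in> carrier_mat n n" using A by (simp add: B_def)
  have Bij: "B $$ (i, j) = of_real (A $$ (i, j))" if "i < n" "j < n" for i j
    using A that by (simp add: B_def)
  obtain as where as: "char_poly B = (\<Prod>a\<leftarrow>as. [:- a, 1:])" "length as = n"
    using char_poly_factorized[OF B] by blast
  have real: "of_real (Re a) = a" if a: "a \<in> set as" for a
  proof -
    have "poly (char_poly B) a = 0"
      using a by (force simp: as(1) poly_prod_list prod_list_zero_iff)
    then obtain v where "eigenvector B v a"
      using eigenvalue_root_char_poly[OF B] by (auto simp: eigenvalue_def)
    then have v: "v \<in> carrier_vec n" "v \<noteq> 0\<^sub>v n" and Bv: "B *\<^sub>v v = a \<cdot>\<^sub>v v"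
      using B by (auto simp: eigenvector_def)
    have Bvi: "(\<Sum>j<n. B $$ (i, j) * v $ j) = a * v $ i" if "i < n" for i
      using arg_cong[OF Bv, of "\<lambda>w. w $ i"] that B v by (simp add: scalar_prod_def atLeast0LessThan)
    define s where "s = (\<Sum>i<n. \<Sum>j<n. cnj (v $ i) * B $$ (i, j) * v $ j)"
    define r where "r = (\<Sum>i<n. (cmod (v $ i))\<^sup>2)"
    have "s = (\<Sum>i<n. cnj (v $ i) * (\<Sum>j<n. B $$ (i, j) * v $ j))"
      by (simp add: s_def sum_distrib_left mult.assoc)
    also have "\<dots> = (\<Sum>i<n. a * of_real ((cmod (v $ i))\<^sup>2))"
      by (rule sum.cong) (simp_all add: Bvi complex_norm_square del: of_real_power)
    finally have s: "s = a * of_real r" by (simp add: r_def sum_distrib_left)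
    have "cnj s = (\<Sum>i<n. \<Sum>j<n. v $ i * B $$ (i, j) * cnj (v $ j))"
      unfolding s_def by (simp add: Bij)
    also have "\<dots> = (\<Sum>j<n. \<Sum>i<n. v $ i * B $$ (i, j) * cnj (v $ j))"
      by (rule sum.swap)
    also have "\<dots> = s"
      unfolding s_def by (intro sum.cong) (simp_all add: Bij sym mult_ac)
    finally have "cnj s = s" .
    obtain i where i: "i < n" "v $ i \<noteq> 0" using v by (metis carrier_vecD eq_vecI index_zero_vec)
    have "r > 0" unfolding r_def by (rule sum_pos2[of _ i]) (use i in auto)
    have "cnj a = a" using \<open>cnj s = s\<close> \<open>r > 0\<close> by (simp add: s)
    then show ?thesis by (simp add: complex_eq_iff)
  qed
  interpret of_real_poly: map_poly_inj_idom_hom complex_of_real ..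
  have "map_poly complex_of_real (char_poly A) = char_poly B"
    by (simp add: B_def of_real_hom.char_poly_hom[OF A])
  also have "\<dots> = (\<Prod>a\<leftarrow>as. [:- of_real (Re a), 1:])"
    unfolding as(1) by (rule arg_cong[of _ _ prod_list]) (simp add: real)
  also have "\<dots> = map_poly of_real (\<Prod>a\<leftarrow>map Re as. [:- a, 1:])"
    by (simp add: of_real_poly.hom_prod_list o_def of_real_hom.map_poly_pCons_hom)
  finally have "char_poly A = (\<Prod>a\<leftarrow>map Re as. [:- a, 1:])" by simp
  then show ?thesis using as(2) by (metis length_map)
qed

section \<open>Symmetry of bipartite spectra and the HL-index\<close>

text \<open>In each term of the Leibniz formula every \<open>s i\<close> occurs twice, once for its
  row and once for its column.\<close>

lemma det_sign_conjugate:
  fixes s :: "nat \<Rightarrow> 'a::comm_ring_1"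
  assumes A: "A \<in> carrier_mat n n" and s: "\<And>i. i < n \<Longrightarrow> s i * s i = 1"
  shows "det (mat n n (\<lambda>(i, j). s i * A $$ (i, j) * s j)) = det A"
proof -
  have "(\<Prod>i = 0..<n. s i * A $$ (i, p i) * s (p i)) = (\<Prod>i = 0..<n. A $$ (i, p i))"
    if p: "p permutes {0..<n}" for p
  proof -
    have "(\<Prod>i = 0..<n. s (p i)) = (\<Prod>i = 0..<n. s i)"
      using prod.permute[OF p, of s] by (simp add: o_def)
    then have "(\<Prod>i = 0..<n. s i * A $$ (i, p i) * s (p i))
        = (\<Prod>i = 0..<n. A $$ (i, p i)) * (\<Prod>i = 0..<n. s i * s i)"
      by (simp add: prod.distrib mult_ac)
    then show ?thesis using s by simp
  qed
  moreover have "p i < n" if "p permutes {0..<n}" "i < n" for p i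
    using permutes_in_image[OF that(1), of i] that(2) by simp
  ultimately show ?thesis
    using A by (simp add: det_def)
qed

text \<open>Conjugation by the diagonal matrix of signs of the 2-colouring negates the adjacency
  matrix, since every edge changes colour, and it preserves determinants.\<close>

lemma bipartite_char_poly_uminus:
  assumes "bipartite_graph n E"
  shows "poly (char_poly (adj_matrix n E)) (- x) = (- 1) ^ n * poly (char_poly (adj_matrix n E)) x"
proof -
  obtain S where S: "\<And>u v. u < n \<Longrightarrow> v < n \<Longrightarrow> E u v \<Longrightarrow> (u \<in> S \<longleftrightarrow> v \<notin> S)"
    using assms unfolding bipartite_graph_def by blast
  define s :: "nat \<Rightarrow> real" where "s i = (if i \<in> S then 1 else - 1)" for i
  let ?A = "adj_matrix n E"
  have A: "?A \<in> carrier_mat n n" by (simp add: adj_matrix_def)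
  define X where "X k = - char_matrix ?A k" for k
  have X: "X k \<in> carrier_mat n n" for k using A by (simp add: X_def)
  have "X (- x) = (- 1) \<cdot>\<^sub>m mat n n (\<lambda>(i, j). s i * X x $$ (i, j) * s j)"
  proof (rule eq_matI)
    fix i j assume "i < dim_row ((- 1) \<cdot>\<^sub>m mat n n (\<lambda>(i, j). s i * X x $$ (i, j) * s j))"
      and "j < dim_col ((- 1) \<cdot>\<^sub>m mat n n (\<lambda>(i, j). s i * X x $$ (i, j) * s j))"
    then have ij: "i < n" "j < n" by simp_all
    have e: "X k $$ (i, j) = (if i = j then k else 0) - (if E i j then 1 else 0)" for k
      using ij by (simp add: X_def char_matrix_def adj_matrix_def)
    have "E i j \<Longrightarrow> s i * s j = - 1" using S[OF ij] by (auto simp: s_def)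
    moreover have "s i * s i = 1" by (simp add: s_def)
    ultimately have "X (- x) $$ (i, j) = - (s i * s j * X x $$ (i, j))"
      unfolding e by (cases "i = j"; cases "E i j") auto
    then show "X (- x) $$ (i, j) = ((- 1) \<cdot>\<^sub>m mat n n (\<lambda>(i, j). s i * X x $$ (i, j) * s j)) $$ (i, j)"
      using ij by (simp add: mult_ac)
  qed (use X in auto)
  then have "det (X (- x)) = (- 1) ^ n * det (mat n n (\<lambda>(i, j). s i * X x $$ (i, j) * s j))"
    by (simp add: det_smult)
  also have "\<dots> = (- 1) ^ n * det (X x)"
    by (subst det_sign_conjugate[OF X]) (auto simp: s_def)
  finally show ?thesis
    by (simp add: char_poly_matrix[OF A] X_def)
qed

text \<open>Negating and reversing the sorted list of a multiset symmetric about \<open>0\<close>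
  gives the same list. The two middle entries, at the zero-based positions \<open>h - 1\<close> and
  \<open>h\<close>, are therefore opposite, and no entry is closer to \<open>0\<close>.\<close>

lemma sorted_list_middle:
  fixes M :: "real multiset"
  assumes size: "size M = 2 * h" and h: "h > 0" and neg: "image_mset uminus M = M"
  defines "xs \<equiv> sorted_list_of_multiset M"
  shows "length xs = 2 * h" "xs ! (h - 1) = - xs ! h" "xs ! h \<ge> 0"
    "\<And>x. x \<in># M \<Longrightarrow> xs ! h \<le> \<bar>x\<bar>"
proof -
  have M: "mset xs = M" and sorted: "sorted xs" by (simp_all add: xs_def)
  show len: "length xs = 2 * h" using size M by (metis size_mset)
  have "sorted (rev (map uminus xs))"
    using sorted by (auto simp: sorted_iff_nth_mono rev_nth)
  moreover have "mset (rev (map uminus xs)) = mset xs" by (simp add: M neg)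
  ultimately have "rev (map uminus xs) = xs"
    using sorted by (metis properties_for_sort sorted_sort_id)
  then have "xs ! (h - 1) = rev (map uminus xs) ! (h - 1)" by simp
  then show mid: "xs ! (h - 1) = - xs ! h"
    using len h by (simp add: rev_nth)
  have "xs ! (h - 1) \<le> xs ! h"
    using sorted len h by (intro sorted_nth_mono) auto
  then show "xs ! h \<ge> 0" using mid by simp
  fix x assume "x \<in># M"
  then obtain j where j: "j < 2 * h" "x = xs ! j" using len by (metis M in_set_conv_nth set_mset_mset)
  show "xs ! h \<le> \<bar>x\<bar>"
  proof (cases "j \<ge> h")
    case True
    then have "xs ! h \<le> x" using j len sorted by (simp add: sorted_nth_mono)
    then show ?thesis by simp
  next
    case False
    then have "x \<le> xs ! (h - 1)" unfolding j(2) using len h by (intro sorted_nth_mono sorted) auto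
    then show ?thesis using mid by simp
  qed
qed

text \<open>Eigenvectors as functions on the vertices, the form that can be carried along a
  relabelling.\<close>

lemma eigenvalue_adj_matrix_iff:
  "eigenvalue (adj_matrix n E) l \<longleftrightarrow>
     (\<exists>f. (\<exists>v<n. f v \<noteq> 0) \<and> (\<forall>v<n. (\<Sum>u | u < n \<and> E v u. f u) = l * f v))" (is "_ \<longleftrightarrow> ?R")
proof -
  let ?A = "adj_matrix n E"
  have A: "?A \<in> carrier_mat n n" by (simp add: adj_matrix_def)
  have Ai: "(?A *\<^sub>v x) $ v = (\<Sum>u | u < n \<and> E v u. x $ u)" if "v < n" "x \<in> carrier_vec n" for x v
  proof -
    have "(?A *\<^sub>v x) $ v = (\<Sum>u<n. if E v u then x $ u else 0)"
      using that by (simp add: adj_matrix_def scalar_prod_def atLeast0LessThan if_distrib[of "\<lambda>c. c * _"] cong: if_cong)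
    also have "\<dots> = (\<Sum>u | u \<in> {..<n} \<and> E v u. x $ u)"
      by (rule sum.inter_filter[symmetric]) simp
    finally show ?thesis by simp
  qed
  show ?thesis
  proof
    assume "eigenvalue ?A l"
    then obtain x where x: "x \<in> carrier_vec n" "x \<noteq> 0\<^sub>v n" and e: "?A *\<^sub>v x = l \<cdot>\<^sub>v x"
      using A by (auto simp: eigenvalue_def eigenvector_def)
    have "\<exists>v<n. x $ v \<noteq> 0" using x by (metis carrier_vecD eq_vecI index_zero_vec)
    moreover have "(\<Sum>u | u < n \<and> E v u. x $ u) = l * x $ v" if "v < n" for v
      using Ai[OF that x(1)] e x that by simp
    ultimately show ?R by (intro exI[of _ "\<lambda>v. x $ v"]) auto
  next
    assume ?R
    then obtain f v where f: "v < n" "f v \<noteq> 0" "\<And>v. v < n \<Longrightarrow> (\<Sum>u | u < n \<and> E v u. f u) = l * f v" by blast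
    have "?A *\<^sub>v vec n f = l \<cdot>\<^sub>v vec n f"
      by (rule eq_vecI) (use A f(3) in \<open>simp_all add: Ai del: index_mult_mat_vec\<close>)
    moreover have "vec n f \<noteq> 0\<^sub>v n" using f by (metis index_vec index_zero_vec(1))
    ultimately show "eigenvalue ?A l"
      using A unfolding eigenvalue_def eigenvector_def by (intro exI[of _ "vec n f"]) auto
  qed
qed

text \<open>By symmetry of the spectrum the two middle eigenvalues are opposite, so the HL-index is
  the least absolute value of an eigenvalue and is itself an eigenvalue. One eigenvalue thus bounds
  it from above, and a bound on all eigenvalues bounds it from below.\<close>

lemma bipartite_HL_index:
  assumes h: "h > 0" and simple: "simple_graph (2 * h) E" and bip: "bipartite_graph (2 * h) E"
  shows "eigenvalue (adj_matrix (2 * h) E) (HL_index (2 * h) E)"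
    and "eigenvalue (adj_matrix (2 * h) E) l \<Longrightarrow> HL_index (2 * h) E \<le> \<bar>l\<bar>"
    and "HL_index (2 * h) E \<ge> 0"
proof -
  let ?A = "adj_matrix (2 * h) E"
  have A: "?A \<in> carrier_mat (2 * h) (2 * h)" by (simp add: adj_matrix_def)
  have "?A $$ (i, j) = ?A $$ (j, i)" if "i < 2 * h" "j < 2 * h" for i j
    using simple that by (auto simp: adj_matrix_def simple_graph_def)
  then obtain es where es: "char_poly ?A = (\<Prod>a\<leftarrow>es. [:- a, 1:])" "length es = 2 * h"
    using real_symmetric_char_poly_splits[OF A] by blast
  have proots: "proots (\<Prod>a\<leftarrow>as. [:- a, 1:]) = mset as" for as :: "real list"
  proof (induction as)
    case (Cons a as)
    have "(\<Prod>a\<leftarrow>as. [:- a, 1:]) \<noteq> 0" by (auto simp: prod_list_zero_iff)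
    then show ?case using Cons by (simp add: proots_mult del: mult_pCons_left)
  qed simp
  define M where "M = proots (char_poly ?A)"
  have M: "M = mset es" by (simp add: M_def es proots)
  have nz: "char_poly ?A \<noteq> 0" using degree_monic_char_poly[OF A] by auto
  have mem: "x \<in># M \<longleftrightarrow> eigenvalue ?A x" for x
    using nz by (simp add: M_def eigenvalue_root_char_poly[OF A])
  \<comment> \<open>The order \<open>2 * h\<close> is even, so the sign in
    \<open>bipartite_char_poly_uminus\<close> is \<open>1\<close> and the roots may be
    negated.\<close>
  have "char_poly ?A = (\<Prod>a\<leftarrow>map uminus es. [:- a, 1:])"
  proof -
    have p: "poly (\<Prod>a\<leftarrow>as. [:- a, 1:]) x = (\<Prod>a\<leftarrow>as. x - a)" for as and x :: real
      by (induction as) (simp_all add: left_diff_distrib)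
    have m: "(\<Prod>a\<leftarrow>as. - x - a) = (- 1) ^ length as * (\<Prod>a\<leftarrow>as. x + a)" for as and x :: real
      by (induction as) (auto simp: algebra_simps)
    have "poly (char_poly ?A) x = poly (\<Prod>a\<leftarrow>map uminus es. [:- a, 1:]) x" for x
    proof -
      have "poly (char_poly ?A) x = poly (char_poly ?A) (- x)"
        using bipartite_char_poly_uminus[OF bip] by simp
      also have "\<dots> = (\<Prod>a\<leftarrow>es. x + a)" by (simp only: es p m) simp
      also have "\<dots> = (\<Prod>a\<leftarrow>map uminus es. x - a)" by (simp add: o_def)
      finally show ?thesis by (simp only: p)
    qed
    then show ?thesis by (intro poly_eq_poly_eq_iff[THEN iffD1]) (rule ext)
  qed
  then have "image_mset uminus M = M"
    by (metis M M_def proots mset_map)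
  note mid = sorted_list_middle[OF _ h this]
  have size: "size M = 2 * h" by (simp add: M es)
  define xs where "xs = sorted_list_of_multiset M"
  have eq: "HL_index (2 * h) E = xs ! h"
  proof -
    have len: "length xs = 2 * h" using mid(1)[OF size] by (simp add: xs_def)
    \<comment> \<open>The eigenvalues of index \<open>h\<close> and \<open>h + 1\<close> in
      decreasing order sit at positions \<open>h\<close> and \<open>h - 1\<close> of the increasing
      zero-based list \<open>xs\<close>.\<close>
    have "adj_eig (2 * h) E ((2 * h + 1) div 2) = xs ! h"
      using h len by (simp add: adj_eig_def adj_eigenvalues_def M_def[symmetric] xs_def[symmetric] rev_nth)
    moreover have "adj_eig (2 * h) E ((2 * h + 2) div 2) = xs ! (h - 1)"
      using h len by (simp add: adj_eig_def adj_eigenvalues_def M_def[symmetric] xs_def[symmetric] rev_nth)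
    ultimately show ?thesis
      using mid(2,3)[OF size] by (simp add: HL_index_def xs_def)
  qed
  have "xs ! h \<in> set xs" by (rule nth_mem) (use mid(1)[OF size] h in \<open>simp add: xs_def\<close>)
  then have "xs ! h \<in># M" by (simp add: xs_def)
  then show "eigenvalue ?A (HL_index (2 * h) E)" by (simp add: eq mem)
  show "HL_index (2 * h) E \<le> \<bar>l\<bar>" if "eigenvalue ?A l"
    using mid(4)[OF size, of l] that by (simp add: eq xs_def mem)
  show "HL_index (2 * h) E \<ge> 0" using mid(3)[OF size] by (simp add: eq xs_def)
qed

section \<open>Projective planes with a polarity\<close>

text \<open>Here \<open>a\<close>, \<open>U\<close>, \<open>R\<close> are the values of a vector on one copy of the plane summed over the
  blocks of the partition given by the flag, and \<open>b\<close> is the value of the next copy at the flag, so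
  that the right-hand side telescopes. The cubic equation is \<open>D (x + \<kappa>) = (1 + \<beta>)\<^sup>2\<close> in
  disguise, which makes the difference a sum of three squares.\<close>

lemma copy_form_lower_bound:
  fixes x Q :: real
  assumes x: "x > 0" and Q: "Q > 0" and cubic: "x\<^sup>2 * (x + Q\<^sup>2 + Q + 1) = 4 * Q ^ 3"
  obtains K where "\<And>a b U R. x * (a\<^sup>2 + U\<^sup>2 / Q + R\<^sup>2 / Q\<^sup>2) + (a + U + R)\<^sup>2 + 2 * U * (b - a) \<ge> K * (a\<^sup>2 - b\<^sup>2)"
proof -
  define W where "W = x + Q\<^sup>2"
  have W: "W > 0" using x Q by (simp add: W_def add_pos_nonneg)
  \<comment> \<open>Minimising \<open>x * R^2 / Q^2 + (c + R)^2\<close> over \<open>R\<close> gives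
    \<open>\<kappa> * c^2\<close>, attained at \<open>R = - \<beta> * c\<close>. \<open>D\<close> is
    the coefficient of \<open>U^2\<close> in what remains.\<close>
  define \<kappa> \<beta> D where "\<kappa> = x / W" and "\<beta> = Q\<^sup>2 / W" and "D = x / Q + \<kappa>"
  have D: "D > 0" using x Q W by (simp add: D_def \<kappa>_def add_pos_pos)
  have \<beta>: "\<beta> \<ge> 0" "\<kappa> = 1 - \<beta>" using W by (simp_all add: \<beta>_def \<kappa>_def W_def field_simps)
  have key: "D * (x + \<kappa>) = (1 + \<beta>)\<^sup>2"
  proof -
    have "x\<^sup>2 * (W + Q) * (W + 1) = W * (x\<^sup>2 * (x + Q\<^sup>2 + Q + 1)) + x\<^sup>2 * Q"
      by (simp add: W_def algebra_simps)
    also have "\<dots> = Q * (W + Q\<^sup>2)\<^sup>2"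
      unfolding cubic by (simp add: W_def power2_eq_square power3_eq_cube algebra_simps)
    finally have e: "x\<^sup>2 * (W + Q) * (W + 1) = Q * (W + Q\<^sup>2)\<^sup>2" .
    have "D * (x + \<kappa>) = x\<^sup>2 * (W + Q) * (W + 1) / (Q * W\<^sup>2)"
      using Q W by (simp add: D_def \<kappa>_def field_simps power2_eq_square)
    also have "\<dots> = (W + Q\<^sup>2)\<^sup>2 / W\<^sup>2" unfolding e using Q by simp
    also have "\<dots> = (1 + \<beta>)\<^sup>2" using W by (simp add: \<beta>_def power_divide[symmetric] add_divide_distrib)
    finally show ?thesis .
  qed
  show thesis
  proof
    fix a b U R :: real
    define c e where "c = a + U" and "e = b - \<beta> * a"
    have 1: "x * R\<^sup>2 / Q\<^sup>2 + (c + R)\<^sup>2 = (x / Q\<^sup>2 + 1) * (R + \<beta> * c)\<^sup>2 + \<kappa> * c\<^sup>2"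
    proof -
      have "(V - Q\<^sup>2) * R\<^sup>2 / Q\<^sup>2 + (c + R)\<^sup>2
          = ((V - Q\<^sup>2) / Q\<^sup>2 + 1) * (R + Q\<^sup>2 / V * c)\<^sup>2 + (V - Q\<^sup>2) / V * c\<^sup>2" if "V > 0" for V
        using Q that by (simp add: field_simps power2_eq_square)
      from this[OF W] show ?thesis by (simp add: \<kappa>_def \<beta>_def W_def)
    qed
    have 2: "x * a\<^sup>2 + x * U\<^sup>2 / Q + \<kappa> * c\<^sup>2 + 2 * U * (b - a) = D * U\<^sup>2 + 2 * U * e + (x + \<kappa>) * a\<^sup>2"
      by (simp add: D_def c_def e_def \<beta>(2) power2_eq_square algebra_simps add_divide_distrib)
    have 3: "D * U\<^sup>2 + 2 * U * e = D * (U + e / D)\<^sup>2 - e\<^sup>2 / D"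
      using D by (simp add: field_simps power2_eq_square)
    \<comment> \<open>By \<open>key\<close>, what is left after completing the square in
      \<open>U\<close> splits into a square and a multiple of \<open>a^2 - b^2\<close>.\<close>
    have 4: "(x + \<kappa>) * a\<^sup>2 - e\<^sup>2 / D = \<beta> / D * (a + b)\<^sup>2 + (1 + \<beta>) / D * (a\<^sup>2 - b\<^sup>2)"
    proof -
      have "x + \<kappa> = (1 + \<beta>)\<^sup>2 / D" using key D by (simp add: field_simps)
      then have "(x + \<kappa>) * a\<^sup>2 - e\<^sup>2 / D = ((1 + \<beta>)\<^sup>2 * a\<^sup>2 - e\<^sup>2) / D" by (simp add: diff_divide_distrib)
      also have "(1 + \<beta>)\<^sup>2 * a\<^sup>2 - e\<^sup>2 = \<beta> * (a + b)\<^sup>2 + (1 + \<beta>) * (a\<^sup>2 - b\<^sup>2)"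
        by (simp add: e_def power2_eq_square algebra_simps)
      finally show ?thesis by (metis add_divide_distrib times_divide_eq_left)
    qed
    have "x * (a\<^sup>2 + U\<^sup>2 / Q + R\<^sup>2 / Q\<^sup>2) + (a + U + R)\<^sup>2 + 2 * U * (b - a)
        = (x * a\<^sup>2 + x * U\<^sup>2 / Q + \<kappa> * c\<^sup>2 + 2 * U * (b - a))
          + (x * R\<^sup>2 / Q\<^sup>2 + (c + R)\<^sup>2) - \<kappa> * c\<^sup>2"
      by (simp add: c_def distrib_left)
    then have "x * (a\<^sup>2 + U\<^sup>2 / Q + R\<^sup>2 / Q\<^sup>2) + (a + U + R)\<^sup>2 + 2 * U * (b - a)
        = (x / Q\<^sup>2 + 1) * (R + \<beta> * c)\<^sup>2 + D * (U + e / D)\<^sup>2 + \<beta> / D * (a + b)\<^sup>2 + (1 + \<beta>) / D * (a\<^sup>2 - b\<^sup>2)"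
      using 1 2 3 4 by linarith
    moreover have "(x / Q\<^sup>2 + 1) * (R + \<beta> * c)\<^sup>2 \<ge> 0" "D * (U + e / D)\<^sup>2 \<ge> 0" "\<beta> / D * (a + b)\<^sup>2 \<ge> 0"
      using x Q D \<beta> by auto
    ultimately show "x * (a\<^sup>2 + U\<^sup>2 / Q + R\<^sup>2 / Q\<^sup>2) + (a + U + R)\<^sup>2 + 2 * U * (b - a) \<ge> (1 + \<beta>) / D * (a\<^sup>2 - b\<^sup>2)"
      by linarith
  qed
qed

section \<open>Roots of the two cubics\<close>

text \<open>Intermediate values: the left-hand side is \<open>0\<close> at \<open>0\<close>, and at
  \<open>2 * sqrt (Q - 1)\<close> it exceeds \<open>4 * Q ^ 3\<close> by
  \<open>8 * (Q - 1) * sqrt (Q - 1) - 4\<close>, which is positive for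
  \<open>Q \<ge> 2\<close>.\<close>

lemma exists_cubic_root_lower:
  fixes Q :: real
  assumes "Q \<ge> 2"
  obtains x where "0 < x" "x < 2 * sqrt (Q - 1)" "x\<^sup>2 * (x + Q\<^sup>2 + Q + 1) = 4 * Q ^ 3"
proof -
  define s where "s = sqrt (Q - 1)"
  have s: "s \<ge> 1" and s2: "s\<^sup>2 = Q - 1" using assms by (simp_all add: s_def)
  let ?f = "\<lambda>x. x\<^sup>2 * (x + Q\<^sup>2 + Q + 1)"
  have "?f (2 * s) = 4 * (Q - 1) * (2 * s + Q\<^sup>2 + Q + 1)"
    by (simp add: power_mult_distrib s2)
  also have "\<dots> = 4 * Q ^ 3 + (8 * (Q - 1) * s - 4)"
    by (simp add: power2_eq_square power3_eq_cube algebra_simps)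
  finally have f: "?f (2 * s) = 4 * Q ^ 3 + (8 * (Q - 1) * s - 4)" .
  have "1 * 1 \<le> (Q - 1) * s" using assms s by (intro mult_mono) auto
  then have f4: "?f (2 * s) > 4 * Q ^ 3" unfolding f by linarith
  have "\<exists>x. 0 \<le> x \<and> x \<le> 2 * s \<and> ?f x = 4 * Q ^ 3"
    by (rule IVT') (use f4 assms s in \<open>auto intro!: continuous_intros\<close>)
  then obtain x where x: "0 \<le> x" "x \<le> 2 * s" "?f x = 4 * Q ^ 3" by blast
  have "x \<noteq> 0" using x(3) assms by auto
  moreover have "x \<noteq> 2 * s" using x(3) f4 by auto
  ultimately show thesis using that[of x] x by (simp add: s_def)
qed

text \<open>The cubic is the characteristic polynomial of the quotient matrix with rows
  \<open>(-1, Q, 0)\<close>, \<open>(1, 0, Q)\<close>, \<open>(0, 1, Q)\<close> of the incidence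
  matrix with negated flag entry. It is positive at \<open>0\<close> and negative at
  \<open>sqrt Q - 1\<close>.\<close>

lemma exists_cubic_root_upper:
  fixes Q :: real
  assumes "Q \<ge> 2"
  obtains \<mu> where "0 < \<mu>" "\<mu> < sqrt Q - 1" "\<mu> ^ 3 + (1 - Q) * \<mu>\<^sup>2 - 3 * Q * \<mu> + Q\<^sup>2 - Q = 0"
proof -
  define s where "s = sqrt Q"
  have s: "s > 1" and Q: "Q = s\<^sup>2" using assms by (simp_all add: s_def)
  let ?f = "\<lambda>x. x ^ 3 + (1 - Q) * x\<^sup>2 - 3 * Q * x + Q\<^sup>2 - Q"
  have "?f (s - 1) = - s * (s - 1)"
    unfolding Q by (simp add: power2_eq_square power3_eq_cube algebra_simps)
  moreover have "s * (s - 1) > 0" using s by simp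
  ultimately have f1: "?f (s - 1) < 0" by linarith
  have "Q * (Q - 1) > 0" using assms by simp
  then have f0: "?f 0 > 0" by (simp add: power2_eq_square algebra_simps)
  have "\<exists>x. 0 \<le> x \<and> x \<le> s - 1 \<and> ?f x = 0"
    by (rule IVT2') (use f0 f1 s in \<open>auto intro!: continuous_intros\<close>)
  then obtain x where x: "0 \<le> x" "x \<le> s - 1" "?f x = 0" by blast
  moreover have "x \<noteq> 0" using x(3) f0 by auto
  moreover have "x \<noteq> s - 1" using x(3) f1 by auto
  ultimately show thesis using that[of x] by (simp add: s_def)
qed

section \<open>Polar planes and the partition given by an absolute point\<close>

text \<open>A projective plane of order \<open>q\<close> whose lines are labelled by points through
  a polarity, so that incidence is a symmetric relation on points and both sides of the incidence
  graph look alike. \<open>\<omega>\<close> is an absolute point, one on its own polar line; it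
  supplies the flag.\<close>

locale polar_plane =
  fixes P :: "'a set" and I :: "'a \<Rightarrow> 'a \<Rightarrow> bool" and \<omega> :: 'a and q :: nat
  assumes finite_P: "finite P" and base: "\<omega> \<in> P" "I \<omega> \<omega>"
    and sym: "x \<in> P \<Longrightarrow> y \<in> P \<Longrightarrow> I x y \<Longrightarrow> I y x"
    and card_nbrs: "x \<in> P \<Longrightarrow> card {y \<in> P. I x y} = q + 1"
    and common: "x \<in> P \<Longrightarrow> y \<in> P \<Longrightarrow> x \<noteq> y \<Longrightarrow> \<exists>!z. z \<in> P \<and> I x z \<and> I y z"
    and card_P: "card P = q\<^sup>2 + q + 1" and q: "q \<ge> 2"
begin

definition nbrs :: "'a \<Rightarrow> 'a set" where "nbrs x = {y \<in> P. I x y}"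

text \<open>The classes \<open>{\<omega>}\<close>, \<open>near\<close> and \<open>far\<close> form
  the equitable partition given by the flag.\<close>

definition near :: "'a set" where "near = {x \<in> P. x \<noteq> \<omega> \<and> I \<omega> x}"

definition far :: "'a set" where "far = {x \<in> P. \<not> I \<omega> x}"

lemma P_split: "P = insert \<omega> (near \<union> far)" "\<omega> \<notin> near" "\<omega> \<notin> far" "near \<inter> far = {}"
  "finite near" "finite far" "near \<subseteq> P" "far \<subseteq> P"
  using base finite_P by (auto simp: near_def far_def)

lemma P_cases:
  assumes "x \<in> P"
  obtains "x = \<omega>" | "x \<in> near" | "x \<in> far"
  using assms by (auto simp: near_def far_def)

lemma nbrs_base: "nbrs \<omega> = insert \<omega> near"
  using base by (auto simp: nbrs_def near_def)

lemma finite_nbrs: "finite (nbrs x)"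
  using finite_P by (simp add: nbrs_def)

lemma card_near: "card near = q"
  using card_nbrs[OF base(1)] nbrs_base P_split by (simp add: nbrs_def)

lemma card_far: "card far = q\<^sup>2"
  using arg_cong[OF P_split(1), of card] card_P P_split(2-6) card_near by (simp add: card_Un_disjoint)

text \<open>\<open>\<omega>\<close> is adjacent to itself and to \<open>x\<close>, so it is their
  only common neighbour, and all other neighbours of \<open>x\<close> are far.\<close>

lemma nbrs_near:
  assumes x: "x \<in> near"
  obtains X where "nbrs x = insert \<omega> X" "X \<subseteq> far" "card X = q" "\<omega> \<notin> X"
proof
  have xP: "x \<in> P" "x \<noteq> \<omega>" "I \<omega> x" using x by (auto simp: near_def)
  have "\<omega> \<in> nbrs x" using sym[OF base(1) xP(1,3)] base by (simp add: nbrs_def)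
  then show "nbrs x = insert \<omega> (nbrs x - {\<omega>})" by blast
  show "card (nbrs x - {\<omega>}) = q"
    using \<open>\<omega> \<in> nbrs x\<close> card_nbrs[OF xP(1)] finite_nbrs by (simp add: nbrs_def)
  show "nbrs x - {\<omega>} \<subseteq> far"
  proof
    fix y assume y: "y \<in> nbrs x - {\<omega>}"
    have "\<not> I \<omega> y"
      using common[OF xP(1) base(1) xP(2)] y \<open>\<omega> \<in> nbrs x\<close> base by (auto simp: nbrs_def)
    then show "y \<in> far" using y by (simp add: far_def nbrs_def)
  qed
qed simp

text \<open>\<open>s\<close> is the unique common neighbour of \<open>x\<close> and
  \<open>\<omega>\<close>; it differs from \<open>\<omega>\<close> because \<open>x\<close> is not
  adjacent to \<open>\<omega>\<close>.\<close>

lemma nbrs_far: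
  assumes x: "x \<in> far"
  obtains s X where "nbrs x = insert s X" "s \<in> near" "X \<subseteq> far" "card X = q" "s \<notin> X"
proof -
  have xP: "x \<in> P" "\<not> I \<omega> x" using x by (auto simp: far_def)
  then have "x \<noteq> \<omega>" using base by auto
  from common[OF xP(1) base(1) this] obtain s where s: "s \<in> P" "I x s" "I \<omega> s"
    and uniq: "\<And>z. z \<in> P \<Longrightarrow> I x z \<Longrightarrow> I \<omega> z \<Longrightarrow> z = s" by blast
  have "s \<noteq> \<omega>" using s sym[OF xP(1) base(1)] xP by auto
  show thesis
  proof
    show "nbrs x = insert s (nbrs x - {s})" using s by (auto simp: nbrs_def)
    show "s \<in> near" using s \<open>s \<noteq> \<omega>\<close> by (simp add: near_def)
    show "nbrs x - {s} \<subseteq> far" using uniq by (auto simp: nbrs_def far_def)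
    show "card (nbrs x - {s}) = q"
      using s card_nbrs[OF xP(1)] finite_nbrs by (simp add: nbrs_def)
  qed simp
qed

lemma sum_P: "sum f P = f \<omega> + sum f near + sum f far" for f :: "'a \<Rightarrow> real"
  using arg_cong[OF P_split(1), of "sum f"] P_split(2-6) by (simp add: sum.union_disjoint)

lemma card_common:
  assumes "y \<in> P" "z \<in> P"
  shows "card {x \<in> P. I x y \<and> I x z} = (if y = z then q + 1 else 1)"
proof (cases "y = z")
  case True
  have "{x \<in> P. I x y} = {x \<in> P. I y x}" using sym assms by blast
  then show ?thesis using True card_nbrs assms by simp
next
  case False
  obtain w where w: "w \<in> P \<and> I y w \<and> I z w" and uniq: "\<And>x. x \<in> P \<and> I y x \<and> I z x \<Longrightarrow> x = w"
    using common[OF assms False] by blast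
  have "{x \<in> P. I x y \<and> I x z} = {w}"
  proof (intro equalityI subsetI)
    show "x \<in> {w}" if "x \<in> {x \<in> P. I x y \<and> I x z}" for x
      using uniq[of x] that sym assms by blast
    show "x \<in> {x \<in> P. I x y \<and> I x z}" if "x \<in> {w}" for x
      using that w sym assms by blast
  qed
  then show ?thesis using False by simp
qed

text \<open>The quadratic form of the identity \<open>A^2 = q I + J\<close> for the incidence matrix
  \<open>A\<close>, which comes from counting common neighbours.\<close>

lemma sum_incidence_square:
  fixes v :: "'a \<Rightarrow> real"
  shows "(\<Sum>x\<in>P. (\<Sum>y\<in>nbrs x. v y)\<^sup>2) = q * (\<Sum>y\<in>P. (v y)\<^sup>2) + (\<Sum>y\<in>P. v y)\<^sup>2"
proof -
  have nb: "(\<Sum>y\<in>nbrs x. v y) = (\<Sum>y\<in>P. if I x y then v y else 0)" for x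
    unfolding nbrs_def by (rule sum.inter_filter[OF finite_P])
  have "(\<Sum>x\<in>P. (\<Sum>y\<in>nbrs x. v y)\<^sup>2)
      = (\<Sum>x\<in>P. \<Sum>y\<in>P. \<Sum>z\<in>P. if I x y \<and> I x z then v y * v z else 0)"
    unfolding nb power2_eq_square sum_product by (intro sum.cong refl) simp
  also have "\<dots> = (\<Sum>y\<in>P. \<Sum>x\<in>P. \<Sum>z\<in>P. if I x y \<and> I x z then v y * v z else 0)"
    by (rule sum.swap)
  also have "\<dots> = (\<Sum>y\<in>P. \<Sum>z\<in>P. \<Sum>x\<in>P. if I x y \<and> I x z then v y * v z else 0)"
    by (intro sum.cong refl sum.swap)
  also have "\<dots> = (\<Sum>y\<in>P. \<Sum>z\<in>P. v y * v z + (if y = z then q * (v y * v z) else 0))"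
  proof (intro sum.cong refl)
    fix y z assume yz: "y \<in> P" "z \<in> P"
    have "(\<Sum>x\<in>P. if I x y \<and> I x z then v y * v z else 0) = card {x \<in> P. I x y \<and> I x z} * (v y * v z)"
      by (subst sum.inter_filter[OF finite_P, symmetric]) simp
    then show "(\<Sum>x\<in>P. if I x y \<and> I x z then v y * v z else 0)
        = v y * v z + (if y = z then q * (v y * v z) else 0)"
      by (simp add: card_common[OF yz] algebra_simps)
  qed
  also have "\<dots> = (\<Sum>y\<in>P. \<Sum>z\<in>P. v y * v z) + (\<Sum>y\<in>P. q * (v y)\<^sup>2)"
    using finite_P by (simp add: sum.distrib power2_eq_square)
  also have "(\<Sum>y\<in>P. \<Sum>z\<in>P. v y * v z) = (\<Sum>y\<in>P. v y)\<^sup>2"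
    by (simp only: power2_eq_square sum_product)
  also have "(\<Sum>y\<in>P. q * (v y)\<^sup>2) = q * (\<Sum>y\<in>P. (v y)\<^sup>2)"
    by (simp only: sum_distrib_left)
  finally show ?thesis by (simp only: add.commute)
qed

text \<open>Cauchy-Schwarz on each class of the partition; only the class sums matter from here
  on.\<close>

lemma sum_square_lower:
  fixes v :: "'a \<Rightarrow> real"
  shows "(v \<omega>)\<^sup>2 + (sum v near)\<^sup>2 / q + (sum v far)\<^sup>2 / q\<^sup>2 \<le> (\<Sum>y\<in>P. (v y)\<^sup>2)"
proof -
  have cs: "(sum v X)\<^sup>2 / card X \<le> (\<Sum>y\<in>X. (v y)\<^sup>2)" if "card X > 0" for X
  proof -
    have "0 \<le> (\<Sum>y\<in>X. (v y - sum v X / card X)\<^sup>2)" by (simp add: sum_nonneg)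
    also have "\<dots> = (\<Sum>y\<in>X. (v y)\<^sup>2 - 2 * (sum v X / card X) * v y + (sum v X / card X)\<^sup>2)"
      by (simp add: power2_eq_square algebra_simps)
    also have "\<dots> = (\<Sum>y\<in>X. (v y)\<^sup>2) - 2 * (sum v X / card X) * sum v X + card X * (sum v X / card X)\<^sup>2"
      by (simp add: sum.distrib sum_subtractf sum_distrib_left)
    also have "\<dots> = (\<Sum>y\<in>X. (v y)\<^sup>2) - (sum v X)\<^sup>2 / card X"
      using that by (simp add: power2_eq_square)
    finally show ?thesis by simp
  qed
  have "(sum v near)\<^sup>2 / q \<le> (\<Sum>y\<in>near. (v y)\<^sup>2)"
    using cs[of near] q by (simp add: card_near)
  moreover have "(sum v far)\<^sup>2 / q\<^sup>2 \<le> (\<Sum>y\<in>far. (v y)\<^sup>2)"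
    using cs[of far] q by (simp add: card_far)
  ultimately show ?thesis by (simp add: sum_P)
qed

text \<open>In copy \<open>i\<close> the incidence of \<open>\<omega>\<close> with itself is redirected to copy \<open>\<tau> i\<close>.\<close>

lemma linked_incidence_form_lower:
  fixes v :: "'j \<Rightarrow> 'a \<Rightarrow> real"
  assumes \<tau>: "bij_betw \<tau> J J"
    and x: "x > 0" "x\<^sup>2 * (x + (real q)\<^sup>2 + real q + 1) = 4 * real q ^ 3"
  shows "(real q - x) * (\<Sum>i\<in>J. \<Sum>y\<in>P. (v i y)\<^sup>2)
    \<le> (\<Sum>i\<in>J. \<Sum>y\<in>P. (\<Sum>z\<in>nbrs y. v (if y = \<omega> \<and> z = \<omega> then \<tau> i else i) z)\<^sup>2)"
proof -
  define L where "L i y = (\<Sum>z\<in>nbrs y. v (if y = \<omega> \<and> z = \<omega> then \<tau> i else i) z)" for i y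
  obtain K where K: "\<And>a b U R. x * (a\<^sup>2 + U\<^sup>2 / real q + R\<^sup>2 / (real q)\<^sup>2) + (a + U + R)\<^sup>2 + 2 * U * (b - a)
      \<ge> K * (a\<^sup>2 - b\<^sup>2)"
    using copy_form_lower_bound[OF x(1) _ x(2)] q by force
  \<comment> \<open>Redirection changes only the component at \<open>\<omega>\<close>, from
    \<open>a + U\<close> to \<open>b + U\<close>. The squares then differ by
    \<open>2 * U * (b - a) - (a^2 - b^2)\<close>, and the last part turns \<open>K\<close> into
    \<open>K - 1\<close>.\<close>
  have copy: "(real q - x) * (\<Sum>y\<in>P. (v i y)\<^sup>2) + (K - 1) * ((v i \<omega>)\<^sup>2 - (v (\<tau> i) \<omega>)\<^sup>2)
      \<le> (\<Sum>y\<in>P. (L i y)\<^sup>2)" for i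
  proof -
    define a b U R where "a = v i \<omega>" and "b = v (\<tau> i) \<omega>" and "U = sum (v i) near" and "R = sum (v i) far"
    have L: "L i y = sum (v i) (nbrs y)" if "y \<noteq> \<omega>" for y
      using that by (simp add: L_def)
    have L\<omega>: "L i \<omega> = b + U" and N\<omega>: "sum (v i) (nbrs \<omega>) = a + U"
    proof -
      have "(\<Sum>z\<in>near. v (if z = \<omega> then \<tau> i else i) z) = U"
        unfolding U_def using P_split(2) by (intro sum.cong) auto
      then show "L i \<omega> = b + U" using P_split by (simp add: L_def nbrs_base b_def)
      show "sum (v i) (nbrs \<omega>) = a + U" using P_split by (simp add: nbrs_base a_def U_def)
    qed
    have "(\<Sum>y\<in>P. (L i y)\<^sup>2) = (\<Sum>y\<in>P. (sum (v i) (nbrs y))\<^sup>2) - (a + U)\<^sup>2 + (b + U)\<^sup>2"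
      using L L\<omega> N\<omega> finite_P base by (simp add: sum.remove[of P \<omega>])
    also have "(\<Sum>y\<in>P. (sum (v i) (nbrs y))\<^sup>2) = q * (\<Sum>y\<in>P. (v i y)\<^sup>2) + (a + U + R)\<^sup>2"
      by (simp only: sum_incidence_square) (simp add: sum_P a_def U_def R_def)
    finally have e: "(\<Sum>y\<in>P. (L i y)\<^sup>2)
        = q * (\<Sum>y\<in>P. (v i y)\<^sup>2) + (a + U + R)\<^sup>2 + 2 * U * (b - a) - (a\<^sup>2 - b\<^sup>2)"
      by (simp add: power2_eq_square algebra_simps)
    have "x * (a\<^sup>2 + U\<^sup>2 / q + R\<^sup>2 / q\<^sup>2) \<le> x * (\<Sum>y\<in>P. (v i y)\<^sup>2)"
      using sum_square_lower[of "v i"] x(1) by (simp add: a_def U_def R_def)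
    then show ?thesis using K[of a b U R] unfolding e by (simp add: a_def b_def algebra_simps)
  qed
  \<comment> \<open>\<open>\<tau>\<close> permutes the copies, so the terms with factor
    \<open>K - 1\<close> cancel in total, whatever its sign.\<close>
  have "(\<Sum>i\<in>J. (v (\<tau> i) \<omega>)\<^sup>2) = (\<Sum>i\<in>J. (v i \<omega>)\<^sup>2)"
    by (rule sum.reindex_bij_betw[OF \<tau>])
  then have "(real q - x) * (\<Sum>i\<in>J. \<Sum>y\<in>P. (v i y)\<^sup>2)
      = (\<Sum>i\<in>J. (real q - x) * (\<Sum>y\<in>P. (v i y)\<^sup>2) + (K - 1) * ((v i \<omega>)\<^sup>2 - (v (\<tau> i) \<omega>)\<^sup>2))"
    by (simp add: sum.distrib sum_distrib_left[symmetric] sum_subtractf)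
  also have "\<dots> \<le> (\<Sum>i\<in>J. \<Sum>y\<in>P. (L i y)\<^sup>2)" by (intro sum_mono copy)
  finally show ?thesis by (simp add: L_def)
qed

end

section \<open>The coordinate plane over the residue field\<close>

datatype 'a plane_point = Affine 'a 'a | Slope 'a | Infinity

context residue_field
begin

text \<open>The point \<open>Affine m b\<close> also stands for the line \<open>y = m x - b\<close>, \<open>Slope c\<close> for the line
  \<open>x = c\<close> and \<open>Infinity\<close> for the line at infinity; the sign of \<open>b\<close> makes incidence symmetric.\<close>

fun incident :: "'a plane_point \<Rightarrow> 'a plane_point \<Rightarrow> bool" where
  "incident (Affine x y) (Affine m b) \<longleftrightarrow> y + b - m * x \<in> M"
| "incident (Affine x y) (Slope c) \<longleftrightarrow> x = c"
| "incident (Affine x y) Infinity \<longleftrightarrow> False"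
| "incident (Slope c) (Affine x y) \<longleftrightarrow> x = c"
| "incident (Slope c) (Slope d) \<longleftrightarrow> False"
| "incident (Slope c) Infinity \<longleftrightarrow> True"
| "incident Infinity (Affine x y) \<longleftrightarrow> False"
| "incident Infinity (Slope c) \<longleftrightarrow> True"
| "incident Infinity Infinity \<longleftrightarrow> True"

lemma incident_sym: "incident x y \<longleftrightarrow> incident y x"
  by (cases x; cases y) (auto simp: algebra_simps)

definition plane_points :: "'a set \<Rightarrow> 'a plane_point set" where
  "plane_points T = insert Infinity (Slope ` T \<union> (\<lambda>(x, y). Affine x y) ` (T \<times> T))"

lemma plane_points_simps [simp]:
  "Affine x y \<in> plane_points T \<longleftrightarrow> x \<in> T \<and> y \<in> T" "Slope c \<in> plane_points T \<longleftrightarrow> c \<in> T"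
  "Infinity \<in> plane_points T"
  by (auto simp: plane_points_def)

text \<open>Coordinates in \<open>T\<close> stand for residues, and joining two points means solving
  linear equations modulo \<open>M\<close>. As incidence is symmetric, the same argument intersects
  two lines.\<close>

lemma polar_plane_over_residue_field:
  assumes T: "T \<subseteq> R" "finite T" "card T = q" "q \<ge> 2"
    and rep: "\<And>x. x \<in> R \<Longrightarrow> \<exists>!t. t \<in> T \<and> x - t \<in> M"
  shows "polar_plane (plane_points T) incident Infinity q"
proof -
  define r where "r x = (THE t. t \<in> T \<and> x - t \<in> M)" for x
  have r: "r x \<in> T" "x - r x \<in> M" if "x \<in> R" for x
    using theI'[OF rep[OF that]] by (simp_all add: r_def)
  have r_unique: "x - t \<in> M \<longleftrightarrow> t = r x" if "x \<in> R" "t \<in> T" for x t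
    using rep[OF that(1)] r[OF that(1)] that(2) by blast
  have TR: "x \<in> R" if "x \<in> T" for x using that T(1) by blast
  have T_cong: "s = t" if "s \<in> T" "t \<in> T" "s - t \<in> M" for s t
    using rep[OF TR[OF that(1)]] that ideal_zero[OF that(3)] by force
  \<comment> \<open>Division in the residue field: if \<open>u\<close> inverts \<open>d\<close>
    modulo \<open>M\<close>, the solution is the representative of \<open>e * u\<close>.\<close>
  have linear: "\<exists>!m. m \<in> T \<and> e - m * d \<in> M" if d: "d \<in> R" "d \<notin> M" and e: "e \<in> R" for d e
  proof (rule ex_ex1I)
    obtain u where u: "u \<in> R" "d * u - 1 \<in> M" using ideal_inverse[OF d] by blast
    have eu: "e * u \<in> R" using mult_closed e u by blast
    have "d * (e * u - r (e * u)) - e * (d * u - 1) \<in> M"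
      using ideal_diff ideal_mult d e u r(2)[OF eu] by blast
    then have "e - r (e * u) * d \<in> M" by (simp add: algebra_simps)
    then show "\<exists>m. m \<in> T \<and> e - m * d \<in> M" using r(1)[OF eu] by blast
  next
    fix m n assume mn: "m \<in> T \<and> e - m * d \<in> M" "n \<in> T \<and> e - n * d \<in> M"
    then have "(e - n * d) - (e - m * d) \<in> M" using ideal_diff by blast
    then have "(m - n) * d \<in> M" by (simp add: algebra_simps)
    then have "m - n \<in> M" using ideal_prime[of "m - n" d] diff_closed TR mn d by blast
    then show "m = n" using T_cong mn by blast
  qed
  have intercept: "y + b - m * x \<in> M \<longleftrightarrow> b = r (m * x - y)" if "x \<in> T" "y \<in> T" "m \<in> T" "b \<in> T" for x y m b
  proof -
    have "y + b - m * x \<in> M \<longleftrightarrow> - (y + b - m * x) \<in> M"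
      using ideal_uminus[of "y + b - m * x"] ideal_uminus[of "- (y + b - m * x)"] by auto
    also have "- (y + b - m * x) = (m * x - y) - b" by simp
    also have "\<dots> \<in> M \<longleftrightarrow> b = r (m * x - y)"
      by (rule r_unique) (use that TR diff_closed mult_closed in auto)
    finally show ?thesis .
  qed
  have rT: "r (m * x - y) \<in> T" if "x \<in> T" "y \<in> T" "m \<in> T" for x y m
    by (rule r(1)) (use that TR diff_closed mult_closed in auto)
  let ?P = "plane_points T"
  \<comment> \<open>\<open>order\<close> selects one order for each pair of points of different
    kinds: affine, then slope, then infinity. The opposite order follows at the end by exchanging
    \<open>x\<close> and \<open>y\<close>.\<close>
  have join: "\<exists>!z. z \<in> ?P \<and> incident a z \<and> incident b z"
    if ab: "a \<in> ?P" "b \<in> ?P" "a \<noteq> b"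
      and order: "case a of Affine _ _ \<Rightarrow> True | Slope _ \<Rightarrow> (\<forall>x y. b \<noteq> Affine x y) | Infinity \<Rightarrow> False" for a b
  proof (cases a)
    case a: (Affine x y)
    then have xy: "x \<in> T" "y \<in> T" using ab by auto
    show ?thesis
    proof (cases b)
      case b: (Affine x' y')
      then have xy': "x' \<in> T" "y' \<in> T" using ab by auto
      show ?thesis
      proof (cases "x = x'")
        case True
        show ?thesis
        proof (rule ex1I[of _ "Slope x"])
          show "Slope x \<in> ?P \<and> incident a (Slope x) \<and> incident b (Slope x)"
            using True xy by (simp add: a b)
          fix z assume z: "z \<in> ?P \<and> incident a z \<and> incident b z"
          show "z = Slope x"
          proof (cases z)
            case (Affine m c)
            then have "y + c - m * x \<in> M" "y' + c - m * x \<in> M" using z True by (auto simp: a b)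
            then have "(y + c - m * x) - (y' + c - m * x) \<in> M" using ideal_diff by blast
            then have "y = y'" using T_cong xy xy' by simp
            then show ?thesis using True ab(3) by (simp add: a b)
          qed (use z in \<open>auto simp: a b\<close>)
        qed
      next
        case False
        have d: "x - x' \<in> R" "x - x' \<notin> M" and e: "y - y' \<in> R"
          using diff_closed TR xy xy' T_cong False by auto
        obtain m where m: "m \<in> T" "(y - y') - m * (x - x') \<in> M"
          and uniq: "\<And>n. n \<in> T \<Longrightarrow> (y - y') - n * (x - x') \<in> M \<Longrightarrow> n = m"
          using linear[OF d e] by blast
        define c where "c = r (m * x - y)"
        have c: "c \<in> T" "y + c - m * x \<in> M"
          using rT intercept xy m(1) by (auto simp: c_def)
        show ?thesis
        proof (rule ex1I[of _ "Affine m c"])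
          have "(y + c - m * x) - ((y - y') - m * (x - x')) \<in> M" using c m ideal_diff by blast
          then have "y' + c - m * x' \<in> M" by (simp add: algebra_simps)
          then show "Affine m c \<in> ?P \<and> incident a (Affine m c) \<and> incident b (Affine m c)"
            using c m by (simp add: a b)
          fix z assume z: "z \<in> ?P \<and> incident a z \<and> incident b z"
          show "z = Affine m c"
          proof (cases z)
            case zz: (Affine n e)
            then have ne: "n \<in> T" "e \<in> T" "y + e - n * x \<in> M" "y' + e - n * x' \<in> M"
              using z by (auto simp: a b)
            have "(y + e - n * x) - (y' + e - n * x') \<in> M" using ne ideal_diff by blast
            then have "(y - y') - n * (x - x') \<in> M" by (simp add: algebra_simps)
            then have "n = m" using uniq ne by blast
            moreover have "e = c" using ne intercept xy m \<open>n = m\<close> by (simp add: c_def)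
            ultimately show ?thesis using zz by simp
          qed (use z False in \<open>auto simp: a b\<close>)
        qed
      qed
    next
      case b: (Slope d)
      then have d: "d \<in> T" using ab by auto
      show ?thesis
      proof (rule ex1I[of _ "Affine d (r (d * x - y))"])
        show "Affine d (r (d * x - y)) \<in> ?P \<and> incident a (Affine d (r (d * x - y))) \<and>
            incident b (Affine d (r (d * x - y)))"
          using intercept[OF xy d rT[OF xy d]] rT[OF xy d] d by (simp add: a b)
        fix z assume "z \<in> ?P \<and> incident a z \<and> incident b z"
        then show "z = Affine d (r (d * x - y))"
          using intercept[OF xy d] by (cases z) (auto simp: a b)
      qed
    next
      case b: Infinity
      show ?thesis
      proof (rule ex1I[of _ "Slope x"])
        show "Slope x \<in> ?P \<and> incident a (Slope x) \<and> incident b (Slope x)"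
          using xy by (simp add: a b)
        show "z = Slope x" if "z \<in> ?P \<and> incident a z \<and> incident b z" for z
          using that by (cases z) (auto simp: a b)
      qed
    qed
  next
    case a: (Slope c)
    show ?thesis
    proof (rule ex1I[of _ Infinity])
      show "Infinity \<in> ?P \<and> incident a Infinity \<and> incident b Infinity"
        using order by (cases b) (auto simp: a)
      show "z = Infinity" if "z \<in> ?P \<and> incident a z \<and> incident b z" for z
        using that ab(3) order by (cases z; cases b) (auto simp: a)
    qed
  qed (use order in simp)
  show ?thesis
  proof
    show "finite ?P" using T(2) by (simp add: plane_points_def)
    show "Infinity \<in> ?P" "incident Infinity Infinity" by simp_all
    show "incident y x" if "incident x y" for x y using that incident_sym by blast
    show "q \<ge> 2" by fact
    have "card ((\<lambda>(x, y). Affine x y) ` (T \<times> T)) = q\<^sup>2" and "card (Slope ` T) = q"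
      using T by (simp_all add: card_image inj_on_def card_cartesian_product power2_eq_square)
    moreover have "Slope ` T \<inter> (\<lambda>(x, y). Affine x y) ` (T \<times> T) = {}" by auto
    moreover have "Infinity \<notin> Slope ` T \<union> (\<lambda>(x, y). Affine x y) ` (T \<times> T)" by auto
    ultimately show "card ?P = q\<^sup>2 + q + 1"
      using T(2) by (simp add: plane_points_def card_Un_disjoint)
    show "card {y \<in> ?P. incident x y} = q + 1" if "x \<in> ?P" for x
    proof (cases x)
      case (Affine u v)
      then have uv: "u \<in> T" "v \<in> T" using that by auto
      have "z \<in> {y \<in> ?P. incident x y} \<longleftrightarrow> z \<in> insert (Slope u) ((\<lambda>m. Affine m (r (m * u - v))) ` T)" for z
        using uv intercept[OF uv] rT[OF uv] by (cases z) (auto simp: Affine)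
      then have "{y \<in> ?P. incident x y} = insert (Slope u) ((\<lambda>m. Affine m (r (m * u - v))) ` T)" by blast
      moreover have "Slope u \<notin> (\<lambda>m. Affine m (r (m * u - v))) ` T" by auto
      ultimately show ?thesis using T by (simp add: card_image inj_on_def)
    next
      case (Slope c)
      then have "z \<in> {y \<in> ?P. incident x y} \<longleftrightarrow> z \<in> insert Infinity (Affine c ` T)" for z
        using that by (cases z) auto
      then have "{y \<in> ?P. incident x y} = insert Infinity (Affine c ` T)" by blast
      moreover have "Infinity \<notin> Affine c ` T" by auto
      ultimately show ?thesis using T by (simp add: card_image inj_on_def)
    next
      case Infinity
      then have "z \<in> {y \<in> ?P. incident x y} \<longleftrightarrow> z \<in> insert Infinity (Slope ` T)" for z
        by (cases z) auto
      then have "{y \<in> ?P. incident x y} = insert Infinity (Slope ` T)" by blast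
      moreover have "Infinity \<notin> Slope ` T" by auto
      ultimately show ?thesis using T by (simp add: card_image inj_on_def)
    qed
    show "\<exists>!z. z \<in> ?P \<and> incident x z \<and> incident y z" if "x \<in> ?P" "y \<in> ?P" "x \<noteq> y" for x y
    proof -
      have "\<exists>!z. z \<in> ?P \<and> incident y z \<and> incident x z \<Longrightarrow> ?thesis" by (simp only: conj_commute)
      then show ?thesis
        using join[OF that] join[OF that(2,1) that(3)[symmetric]] that(3)
        by (cases x; cases y) auto
    qed
  qed
qed

end

lemma exists_polar_plane:
  assumes "prime_power q"
  shows "\<exists>(P::complex plane_point set) I \<omega>. polar_plane P I \<omega> q"
proof -
  obtain p m where q: "prime p" "m \<ge> 1" "q = p ^ m" using assms by (auto simp: prime_power_def)
  then have "q \<ge> 2" using prime_ge_2_nat[OF q(1)] self_le_power[of p m] by linarith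
  moreover obtain R M T where "residue_field R M" "T \<subseteq> R" "finite T" "card T = q"
    and rep: "\<forall>x\<in>R. \<exists>!t::complex. t \<in> T \<and> x - t \<in> M"
    using exists_residue_field_of_prime_power_order[OF q] by blast
  ultimately show ?thesis
    using residue_field.polar_plane_over_residue_field[of R M T q] by blast
qed

section \<open>Cyclically linked copies of a plane\<close>

text \<open>Relabels a finite graph by an initial segment of the naturals, eigenvalue equations
  included. Loops are excluded by the colouring.\<close>

lemma graph_on_naturals:
  fixes V :: "'v set" and R :: "'v \<Rightarrow> 'v \<Rightarrow> bool"
  assumes V: "finite V" "V \<noteq> {}"
    and sym: "\<And>u v. u \<in> V \<Longrightarrow> v \<in> V \<Longrightarrow> R u v \<Longrightarrow> R v u"
    and col: "\<And>u v. u \<in> V \<Longrightarrow> v \<in> V \<Longrightarrow> R u v \<Longrightarrow> u \<in> C \<longleftrightarrow> v \<notin> C"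
    and reg: "\<And>v. v \<in> V \<Longrightarrow> card {u \<in> V. R v u} = k"
    and conn: "\<And>u v. u \<in> V \<Longrightarrow> v \<in> V \<Longrightarrow> (\<lambda>x y. x \<in> V \<and> y \<in> V \<and> R x y)\<^sup>*\<^sup>* u v"
  obtains E where "simple_graph (card V) E" "connected_graph (card V) E" "bipartite_graph (card V) E"
    "regular_graph (card V) E k"
    "\<And>l. eigenvalue (adj_matrix (card V) E) l \<longleftrightarrow>
       (\<exists>F. (\<exists>v\<in>V. F v \<noteq> 0) \<and> (\<forall>v\<in>V. (\<Sum>u | u \<in> V \<and> R v u. F u) = l * F v))"
proof -
  obtain g where g: "bij_betw g {..<card V} V"
    using ex_bij_betw_nat_finite[OF V(1)] by (auto simp: atLeast0LessThan)
  define g' where "g' = inv_into {..<card V} g"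
  have gV: "g i \<in> V" if "i < card V" for i using g that by (auto simp: bij_betw_def)
  have g'V: "g' v < card V" "g (g' v) = v" if "v \<in> V" for v
  proof -
    have "v \<in> g ` {..<card V}" using g that by (simp add: bij_betw_def)
    then show "g' v < card V" "g (g' v) = v"
      using inv_into_into[of v g "{..<card V}"] by (auto simp: g'_def f_inv_into_f)
  qed
  have gg': "g' (g i) = i" if "i < card V" for i
    using g that by (simp add: g'_def bij_betw_def)
  define E where "E i j = R (g i) (g j)" for i j
  have nbrs: "bij_betw g {u. u < card V \<and> E v u} {u \<in> V. R (g v) u}" for v
    by (rule bij_betw_byWitness[of _ g']) (auto simp: E_def gV g'V gg')
  show thesis
  proof
    have "\<not> R v v" if "v \<in> V" for v using col[OF that that] by blast
    then show "simple_graph (card V) E"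
      using sym gV by (auto simp: simple_graph_def E_def)
    show "bipartite_graph (card V) E"
      unfolding bipartite_graph_def E_def
      by (rule exI[of _ "{i. g i \<in> C}"]) (use col gV in blast)
    show "regular_graph (card V) E k"
      unfolding regular_graph_def using bij_betw_same_card[OF nbrs] reg gV by simp
    have path: "(\<lambda>x y. x < card V \<and> y < card V \<and> E x y)\<^sup>*\<^sup>* (g' u) (g' v)"
      if "(\<lambda>x y. x \<in> V \<and> y \<in> V \<and> R x y)\<^sup>*\<^sup>* u v" for u v
      using that
    proof (induction rule: rtranclp_induct)
      case (step y z)
      then show ?case by (intro rtranclp.rtrancl_into_rtrancl[OF step.IH]) (simp add: E_def g'V)
    qed simp
    show "connected_graph (card V) E"
      unfolding connected_graph_def
    proof (intro conjI allI impI)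
      show "card V > 0" using V by (simp add: card_gt_0_iff)
      show "(\<lambda>x y. x < card V \<and> y < card V \<and> E x y)\<^sup>*\<^sup>* i j" if "i < card V" "j < card V" for i j
        using path[OF conn[OF gV[OF that(1)] gV[OF that(2)]]] by (simp add: gg' that)
    qed
    fix l
    have sum: "(\<Sum>u | u < card V \<and> E v u. F (g u)) = (\<Sum>u | u \<in> V \<and> R (g v) u. F u)" for v and F :: "'v \<Rightarrow> real"
      by (rule sum.reindex_bij_betw[OF nbrs])
    show "eigenvalue (adj_matrix (card V) E) l \<longleftrightarrow>
       (\<exists>F. (\<exists>v\<in>V. F v \<noteq> 0) \<and> (\<forall>v\<in>V. (\<Sum>u | u \<in> V \<and> R v u. F u) = l * F v))"
      unfolding eigenvalue_adj_matrix_iff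
    proof
      assume "\<exists>f. (\<exists>v<card V. f v \<noteq> 0) \<and> (\<forall>v<card V. (\<Sum>u | u < card V \<and> E v u. f u) = l * f v)"
      then obtain f i where f: "i < card V" "f i \<noteq> 0"
        "\<And>v. v < card V \<Longrightarrow> (\<Sum>u | u < card V \<and> E v u. f u) = l * f v" by blast
      have "(\<Sum>u | u \<in> V \<and> R v u. f (g' u)) = l * f (g' v)" if v: "v \<in> V" for v
      proof -
        have "(\<Sum>u | u \<in> V \<and> R v u. f (g' u)) = (\<Sum>u | u < card V \<and> E (g' v) u. f (g' (g u)))"
          using sum[of "f \<circ> g'" "g' v"] g'V[OF v] by simp
        also have "\<dots> = (\<Sum>u | u < card V \<and> E (g' v) u. f u)"
          by (rule sum.cong) (simp_all add: gg')
        finally show ?thesis using f(3) g'V[OF v] by simp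
      qed
      moreover have "\<exists>v\<in>V. f (g' v) \<noteq> 0" using f(1,2) gV gg' by (intro bexI[of _ "g i"]) auto
      ultimately show "\<exists>F. (\<exists>v\<in>V. F v \<noteq> 0) \<and> (\<forall>v\<in>V. (\<Sum>u | u \<in> V \<and> R v u. F u) = l * F v)"
        by (intro exI[of _ "f \<circ> g'"]) auto
    next
      assume "\<exists>F. (\<exists>v\<in>V. F v \<noteq> 0) \<and> (\<forall>v\<in>V. (\<Sum>u | u \<in> V \<and> R v u. F u) = l * F v)"
      then obtain F w where F: "w \<in> V" "F w \<noteq> 0"
        "\<And>v. v \<in> V \<Longrightarrow> (\<Sum>u | u \<in> V \<and> R v u. F u) = l * F v" by blast
      have "\<exists>v<card V. F (g v) \<noteq> 0" using F(1,2) g'V by (intro exI[of _ "g' w"]) auto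
      moreover have "\<forall>v<card V. (\<Sum>u | u < card V \<and> E v u. F (g u)) = l * F (g v)"
        by (simp add: sum F(3) gV)
      ultimately show "\<exists>f. (\<exists>v<card V. f v \<noteq> 0) \<and> (\<forall>v<card V. (\<Sum>u | u < card V \<and> E v u. f u) = l * f v)"
        by (intro exI[of _ "F \<circ> g"]) auto
    qed
  qed
qed

section \<open>Construction and connectedness of the linked copies\<close>

text \<open>\<open>s\<close> is the side of the bipartition. One side links to the next copy and the
  other to the previous one, so that the two shifts are inverse and linking is symmetric.\<close>

definition cyclic_shift :: "nat \<Rightarrow> bool \<Rightarrow> nat \<Rightarrow> nat" where
  "cyclic_shift N s i = (if s then (if i = 0 then N - 1 else i - 1) else (if Suc i = N then 0 else Suc i))"

lemma cyclic_shift_less: "i < N \<Longrightarrow> cyclic_shift N s i < N"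
  by (auto simp: cyclic_shift_def)

lemma cyclic_shift_inverse: "i < N \<Longrightarrow> cyclic_shift N (\<not> s) (cyclic_shift N s i) = i"
  by (auto simp: cyclic_shift_def)

lemma cyclic_shift_bij: "bij_betw (cyclic_shift N s) {..<N} {..<N}"
  by (rule bij_betw_byWitness[of _ "cyclic_shift N (\<not> s)"])
    (use cyclic_shift_inverse[of _ N s] cyclic_shift_inverse[of _ N "\<not> s"] in
      \<open>auto simp: cyclic_shift_less\<close>)

text \<open>As \<open>N\<close> is even, the wrap-around changes parity like every other
  step.\<close>

lemma cyclic_shift_sign:
  assumes "even N" "i < N"
  shows "(- 1 :: real) ^ cyclic_shift N s i = - ((- 1) ^ i)"
proof -
  have "even (cyclic_shift N s i) \<longleftrightarrow> odd i"
    using assms by (cases N; cases i) (auto simp: cyclic_shift_def)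
  then show ?thesis by (cases "even i") auto
qed

context polar_plane
begin

context
  fixes N :: nat
  assumes N: "even N" "N > 0"
begin

text \<open>The components are the side of the bipartition, the index of the copy and the point of
  the plane.\<close>

definition linked_vertices :: "(bool \<times> nat \<times> 'a) set" where
  "linked_vertices = UNIV \<times> {..<N} \<times> P"

text \<open>Only the flag edge leaves its copy.\<close>

definition target :: "bool \<Rightarrow> nat \<Rightarrow> 'a \<Rightarrow> 'a \<Rightarrow> nat" where
  "target s i x y = (if x = \<omega> \<and> y = \<omega> then cyclic_shift N s i else i)"

fun linked :: "bool \<times> nat \<times> 'a \<Rightarrow> bool \<times> nat \<times> 'a \<Rightarrow> bool" where
  "linked (s, i, x) (t, j, y) \<longleftrightarrow> t \<noteq> s \<and> I x y \<and> j = target s i x y"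

lemma linked_nbrs:
  assumes "i < N" "x \<in> P"
  shows "{u \<in> linked_vertices. linked (s, i, x) u} = (\<lambda>y. (\<not> s, target s i x y, y)) ` nbrs x"
  using assms cyclic_shift_less[of i N s] by (auto simp: linked_vertices_def nbrs_def target_def)

lemma linked_sum:
  fixes F :: "bool \<times> nat \<times> 'a \<Rightarrow> real"
  assumes "i < N" "x \<in> P"
  shows "(\<Sum>u | u \<in> linked_vertices \<and> linked (s, i, x) u. F u) = (\<Sum>y\<in>nbrs x. F (\<not> s, target s i x y, y))"
  unfolding linked_nbrs[OF assms] by (subst sum.reindex) (auto intro: inj_onI)

lemma linked_degree:
  assumes "v \<in> linked_vertices"
  shows "card {u \<in> linked_vertices. linked v u} = q + 1"
proof -
  obtain s i x where v: "v = (s, i, x)" "i < N" "x \<in> P" using assms by (auto simp: linked_vertices_def)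
  show ?thesis
    unfolding v(1) linked_nbrs[OF v(2,3)] using card_nbrs[OF v(3)]
    by (subst card_image) (auto intro: inj_onI simp: nbrs_def)
qed

lemma linked_sym:
  assumes "u \<in> linked_vertices" "v \<in> linked_vertices" "linked u v"
  shows "linked v u"
proof -
  obtain s i x t j y where uv: "u = (s, i, x)" "v = (t, j, y)" by (metis prod_cases3)
  have "t = (\<not> s)" "i < N" "x \<in> P" "y \<in> P" "I x y" "j = target s i x y"
    using assms by (auto simp: uv linked_vertices_def)
  then show ?thesis
    using sym cyclic_shift_inverse[of i N s] by (auto simp: uv target_def)
qed

text \<open>Inside a copy, far vertices reach a base vertex through near ones without the flag edge.
  An edge between two far points connects the two sides, and the redirected flag edges connect
  consecutive copies.\<close>

lemma linked_connected:
  assumes "u \<in> linked_vertices" "v \<in> linked_vertices"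
  shows "(\<lambda>x y. x \<in> linked_vertices \<and> y \<in> linked_vertices \<and> linked x y)\<^sup>*\<^sup>* u v"
proof -
  define r where "r x y \<longleftrightarrow> x \<in> linked_vertices \<and> y \<in> linked_vertices \<and> linked x y" for x y
  have "symp r" unfolding symp_def r_def using linked_sym by blast
  then have rsym: "r\<^sup>*\<^sup>* x y \<Longrightarrow> r\<^sup>*\<^sup>* y x" for x y
    by (rule sympD[OF symp_rtranclp])
  have edge: "r\<^sup>*\<^sup>* (s, i, x) (\<not> s, i, y)" if "i < N" "y \<in> nbrs x" "x \<in> P" "x \<noteq> \<omega> \<or> y \<noteq> \<omega>" for s i x y
    by (rule r_into_rtranclp) (use that in \<open>auto simp: r_def linked_vertices_def nbrs_def target_def\<close>)
  have near: "r\<^sup>*\<^sup>* (s, i, x) (\<not> s, i, \<omega>)" if i: "i < N" and x: "x \<in> near" for s i x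
  proof -
    obtain X where "nbrs x = insert \<omega> X" using nbrs_near[OF x] by blast
    moreover have "x \<in> P" "x \<noteq> \<omega>" using x by (auto simp: near_def)
    ultimately show ?thesis using edge[OF i, of \<omega> x s] by simp
  qed
  have far: "r\<^sup>*\<^sup>* (s, i, x) (s, i, \<omega>)" if i: "i < N" and x: "x \<in> far" for s i x
  proof -
    obtain z X where z: "nbrs x = insert z X" "z \<in> near" "X \<subseteq> far" "card X = q" "z \<notin> X"
      by (rule nbrs_far[OF x])
    have "x \<in> P" "z \<noteq> \<omega>" using x z(2) by (auto simp: near_def far_def)
    then have "r\<^sup>*\<^sup>* (s, i, x) (\<not> s, i, z)" using edge[OF i, of z x s] z(1) by simp
    also have "r\<^sup>*\<^sup>* (\<not> s, i, z) (s, i, \<omega>)" using near[OF i z(2), of "\<not> s"] by (simp only: not_not)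
    finally show ?thesis .
  qed
  have side: "r\<^sup>*\<^sup>* (False, i, \<omega>) (True, i, \<omega>)" if i: "i < N" for i
  proof -
    have "far \<noteq> {}" using card_far q by force
    then obtain x where x: "x \<in> far" by blast
    obtain z X where X: "nbrs x = insert z X" "z \<in> near" "X \<subseteq> far" "card X = q" "z \<notin> X"
      by (rule nbrs_far[OF x])
    have "X \<noteq> {}" using X(4) q by force
    then obtain y where y: "y \<in> X" by blast
    have "r\<^sup>*\<^sup>* (False, i, \<omega>) (False, i, x)" by (rule rsym) (rule far[OF i x])
    also have "r\<^sup>*\<^sup>* (False, i, x) (True, i, y)"
      using edge[of i y x False] i x y X(1) P_split(3,8) by auto
    also have "r\<^sup>*\<^sup>* (True, i, y) (True, i, \<omega>)" using far[OF i, of y True] X(3) y by blast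
    finally show ?thesis .
  qed
  have copies: "r\<^sup>*\<^sup>* (False, 0, \<omega>) (False, i, \<omega>)" if "i < N" for i
    using that
  proof (induction i)
    case (Suc i)
    have "r\<^sup>*\<^sup>* (False, 0, \<omega>) (False, i, \<omega>)" using Suc by simp
    also have "r\<^sup>*\<^sup>* (False, i, \<omega>) (True, Suc i, \<omega>)"
      by (rule r_into_rtranclp) (use Suc base in \<open>auto simp: r_def linked_vertices_def target_def cyclic_shift_def\<close>)
    also have "r\<^sup>*\<^sup>* (True, Suc i, \<omega>) (False, Suc i, \<omega>)" by (rule rsym) (rule side[OF Suc.prems])
    finally show ?case .
  qed simp
  have root: "r\<^sup>*\<^sup>* (False, 0, \<omega>) w" if wV: "w \<in> linked_vertices" for w
  proof -
    obtain s i x where w: "w = (s, i, x)" "i < N" "x \<in> P" using wV by (auto simp: linked_vertices_def)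
    have base_side: "r\<^sup>*\<^sup>* (False, i, \<omega>) (t, i, \<omega>)" for t using side[OF w(2)] by (cases t) auto
    have "r\<^sup>*\<^sup>* (s, i, x) (False, i, \<omega>)"
    proof -
      from w(3) show ?thesis
      proof (cases rule: P_cases)
        case 1
        then show ?thesis using rsym[OF base_side] by simp
      next
        case 2
        from near[OF w(2) this] rsym[OF base_side] show ?thesis by (rule rtranclp_trans)
      next
        case 3
        from far[OF w(2) this] rsym[OF base_side] show ?thesis by (rule rtranclp_trans)
      qed
    qed
    from copies[OF w(2)] rsym[OF this] show ?thesis
      unfolding w(1) by (rule rtranclp_trans)
  qed
  from rsym[OF root[OF assms(1)]] root[OF assms(2)] have "r\<^sup>*\<^sup>* u v" by (rule rtranclp_trans)
  then show ?thesis by (simp only: r_def[abs_def])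
qed

section \<open>Spectral bounds for the linked graph\<close>

text \<open>\<open>T s\<close> is the squared norm of \<open>F\<close> on side \<open>s\<close>.
  Adjacency maps the part of \<open>F\<close> on the other side to \<open>l\<close> times its part
  on side \<open>s\<close>, so the form bound applies to each side; the two inequalities are
  added.\<close>

lemma linked_eigenvalue_lower:
  assumes x: "x > 0" "x\<^sup>2 * (x + (real q)\<^sup>2 + real q + 1) = 4 * real q ^ 3"
    and F: "w \<in> linked_vertices" "F w \<noteq> 0"
      "\<And>v. v \<in> linked_vertices \<Longrightarrow> (\<Sum>u | u \<in> linked_vertices \<and> linked v u. F u) = l * F v"
  shows "real q - x \<le> l\<^sup>2"
proof -
  define T where "T s = (\<Sum>i<N. \<Sum>y\<in>P. (F (s, i, y))\<^sup>2)" for s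
  have T0: "T s \<ge> 0" for s unfolding T_def by (intro sum_nonneg) auto
  have step: "(real q - x) * T (\<not> s) \<le> l\<^sup>2 * T s" for s
  proof -
    have e: "(\<Sum>z\<in>nbrs y. F (\<not> s, if y = \<omega> \<and> z = \<omega> then cyclic_shift N s i else i, z)) = l * F (s, i, y)"
      if "i < N" "y \<in> P" for i y
      using F(3)[of "(s, i, y)"] linked_sum[OF that, where s = s and F = F] that
      by (simp add: linked_vertices_def target_def)
    have "(real q - x) * T (\<not> s)
      \<le> (\<Sum>i<N. \<Sum>y\<in>P. (\<Sum>z\<in>nbrs y. F (\<not> s, if y = \<omega> \<and> z = \<omega> then cyclic_shift N s i else i, z))\<^sup>2)"
      unfolding T_def
      using linked_incidence_form_lower[OF cyclic_shift_bij[of N s] x, of "\<lambda>i y. F (\<not> s, i, y)"] by simp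
    also have "\<dots> = (\<Sum>i<N. \<Sum>y\<in>P. (l * F (s, i, y))\<^sup>2)"
      by (intro sum.cong refl) (simp add: e)
    finally show ?thesis by (simp add: T_def power_mult_distrib sum_distrib_left)
  qed
  obtain s i y where w: "w = (s, i, y)" "i < N" "y \<in> P" using F(1) by (auto simp: linked_vertices_def)
  have "T s > 0"
  proof -
    have "(F (s, i, y))\<^sup>2 \<le> (\<Sum>y\<in>P. (F (s, i, y))\<^sup>2)"
      by (rule member_le_sum) (use w finite_P in auto)
    also have "\<dots> \<le> T s"
      unfolding T_def by (rule member_le_sum) (use w in \<open>auto intro: sum_nonneg\<close>)
    finally have "(F (s, i, y))\<^sup>2 \<le> T s" .
    moreover have "(F (s, i, y))\<^sup>2 > 0" using F(2) w(1) by simp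
    ultimately show ?thesis by linarith
  qed
  then have "T True + T False > 0" using T0[of True] T0[of False] by (cases s) auto
  moreover have "(real q - x) * (T True + T False) \<le> l\<^sup>2 * (T True + T False)"
    using step[of True] step[of False] by (simp add: algebra_simps)
  ultimately show ?thesis by (simp add: mult_le_cancel_right)
qed

text \<open>With the sign \<open>(-1) ^ i\<close> on copy \<open>i\<close>, the redirected edge
  contributes \<open>- f \<omega>\<close> instead of \<open>f \<omega>\<close>, which explains the
  correction by \<open>2 * f \<omega>\<close>.\<close>

lemma linked_eigenvector:
  assumes \<mu>: "\<mu> ^ 3 + (1 - real q) * \<mu>\<^sup>2 - 3 * real q * \<mu> + (real q)\<^sup>2 - real q = 0"
  obtains F where "\<exists>v\<in>linked_vertices. F v \<noteq> 0"
    "\<And>v. v \<in> linked_vertices \<Longrightarrow> (\<Sum>u | u \<in> linked_vertices \<and> linked v u. F u) = \<mu> * F v"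
proof -
  \<comment> \<open>With the value \<open>1\<close> on \<open>far\<close>, the equations at far and
    near points determine the values on \<open>near\<close> and at \<open>\<omega>\<close>; the
    equation at \<open>\<omega>\<close> is then the cubic for \<open>\<mu>\<close>.\<close>
  define f where "f x = (if x = \<omega> then \<mu> * (\<mu> - q) - q else if x \<in> near then \<mu> - q else 1)" for x
  have f: "f \<omega> = \<mu> * (\<mu> - q) - q" "x \<in> near \<Longrightarrow> f x = \<mu> - q" "x \<in> far \<Longrightarrow> f x = 1" for x
    using P_split by (auto simp: f_def)
  have sum_far: "sum f X = card X" if "X \<subseteq> far" for X
    using that by (simp add: f(3) subset_iff)
  have fin: "X \<subseteq> far \<Longrightarrow> finite X" for X using P_split by (metis finite_subset)
  have sum_f: "sum f (nbrs x) - (if x = \<omega> then 2 * f \<omega> else 0) = \<mu> * f x" if "x \<in> P" for x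
  proof -
    from that show ?thesis
    proof (cases rule: P_cases)
      case 1
      have "sum f (nbrs \<omega>) = f \<omega> + q * (\<mu> - q)"
        using P_split by (simp add: nbrs_base f(2) card_near)
      then show ?thesis
        using 1 \<mu> by (simp add: f(1) power2_eq_square power3_eq_cube algebra_simps)
    next
      case 2
      obtain X where X: "nbrs x = insert \<omega> X" "X \<subseteq> far" "card X = q" "\<omega> \<notin> X"
        using nbrs_near[OF 2] by blast
      have "x \<noteq> \<omega>" using 2 P_split by auto
      then show ?thesis using X fin[OF X(2)] 2 by (simp add: sum_far f)
    next
      case 3
      obtain z X where X: "nbrs x = insert z X" "z \<in> near" "X \<subseteq> far" "card X = q" "z \<notin> X"
        using nbrs_far[OF 3] by blast
      have "x \<noteq> \<omega>" using 3 P_split by auto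
      then show ?thesis using X fin[OF X(3)] 3 by (simp add: sum_far f)
    qed
  qed
  define F where "F = (\<lambda>(s::bool, i, x). (- 1) ^ i * f x)"
  show thesis
  proof
    have "far \<noteq> {}" using card_far q by force
    then obtain x where "x \<in> far" by blast
    then show "\<exists>v\<in>linked_vertices. F v \<noteq> 0"
      using N P_split by (intro bexI[of _ "(True, 0, x)"]) (auto simp: F_def f linked_vertices_def)
    fix v assume "v \<in> linked_vertices"
    then obtain s i x where v: "v = (s, i, x)" "i < N" "x \<in> P" by (auto simp: linked_vertices_def)
    have "(\<Sum>u | u \<in> linked_vertices \<and> linked v u. F u) = (\<Sum>y\<in>nbrs x. F (\<not> s, target s i x y, y))"
      unfolding v(1) by (rule linked_sum[OF v(2,3)])
    also have "\<dots> = (\<Sum>y\<in>nbrs x. (- 1) ^ i * (f y - (if x = \<omega> \<and> y = \<omega> then 2 * f \<omega> else 0)))"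
      by (intro sum.cong refl)
        (simp add: F_def target_def cyclic_shift_sign[OF N(1) v(2)])
    also have "\<dots> = (- 1) ^ i * (sum f (nbrs x) - (\<Sum>y\<in>nbrs x. if x = \<omega> \<and> y = \<omega> then 2 * f \<omega> else 0))"
      by (simp add: sum_distrib_left[symmetric] sum_subtractf)
    also have "(\<Sum>y\<in>nbrs x. if x = \<omega> \<and> y = \<omega> then 2 * f \<omega> else 0) = (if x = \<omega> then 2 * f \<omega> else 0)"
      using P_split(5) by (cases "x = \<omega>") (simp_all add: nbrs_base)
    finally show "(\<Sum>u | u \<in> linked_vertices \<and> linked v u. F u) = \<mu> * F v"
      using sum_f[OF v(3)] by (simp add: F_def v(1))
  qed
qed

text \<open>The HL-index is an eigenvalue, so the lower bound on all eigenvalues applies to it; the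
  eigenvalue \<open>\<mu>\<close> bounds it from above.\<close>

lemma linked_graph:
  "\<exists>E. simple_graph (card linked_vertices) E \<and> connected_graph (card linked_vertices) E \<and>
     bipartite_graph (card linked_vertices) E \<and> regular_graph (card linked_vertices) E (q + 1) \<and>
     sqrt (real q - 1) - 1 < HL_index (card linked_vertices) E \<and>
     HL_index (card linked_vertices) E < sqrt (real q) - 1"
proof -
  have fin: "finite linked_vertices" using finite_P by (simp add: linked_vertices_def)
  have ne: "linked_vertices \<noteq> {}" using N base by (auto simp: linked_vertices_def)
  have card: "card linked_vertices = 2 * (N * card P)"
    by (simp add: linked_vertices_def card_cartesian_product)
  have "card P > 0" using card_P by simp
  then have pos: "N * card P > 0" using N by simp
  have col: "u \<in> {w. fst w} \<longleftrightarrow> v \<notin> {w. fst w}"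
    if "u \<in> linked_vertices" "v \<in> linked_vertices" "linked u v" for u v
    using that by (cases u; cases v) auto
  obtain E where E: "simple_graph (card linked_vertices) E" "connected_graph (card linked_vertices) E"
    "bipartite_graph (card linked_vertices) E" "regular_graph (card linked_vertices) E (q + 1)"
    and eig: "\<And>l. eigenvalue (adj_matrix (card linked_vertices) E) l \<longleftrightarrow>
       (\<exists>F. (\<exists>v\<in>linked_vertices. F v \<noteq> 0) \<and>
         (\<forall>v\<in>linked_vertices. (\<Sum>u | u \<in> linked_vertices \<and> linked v u. F u) = l * F v))"
    by (rule graph_on_naturals[OF fin ne linked_sym col linked_degree linked_connected])
      (assumption | rule that)+
  note HL = bipartite_HL_index[OF pos E(1)[unfolded card] E(3)[unfolded card], folded card]
  have q2: "real q \<ge> 2" using q by simp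
  obtain x where x: "0 < x" "x < 2 * sqrt (real q - 1)" "x\<^sup>2 * (x + (real q)\<^sup>2 + real q + 1) = 4 * real q ^ 3"
    by (rule exists_cubic_root_lower[OF q2])
  obtain F w where F: "w \<in> linked_vertices" "F w \<noteq> 0"
    "\<And>v. v \<in> linked_vertices \<Longrightarrow> (\<Sum>u | u \<in> linked_vertices \<and> linked v u. F u)
       = HL_index (card linked_vertices) E * F v"
    using HL(1) eig by blast
  have "(sqrt (real q - 1) - 1)\<^sup>2 = real q - 2 * sqrt (real q - 1)"
    using q2 by (simp add: power2_eq_square algebra_simps)
  also have "\<dots> < (HL_index (card linked_vertices) E)\<^sup>2"
    using linked_eigenvalue_lower[OF x(1,3) F] x(2) by simp
  finally have lower: "sqrt (real q - 1) - 1 < HL_index (card linked_vertices) E"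
    using HL(3) by (rule power_less_imp_less_base)
  obtain \<mu> where \<mu>: "0 < \<mu>" "\<mu> < sqrt (real q) - 1"
    "\<mu> ^ 3 + (1 - real q) * \<mu>\<^sup>2 - 3 * real q * \<mu> + (real q)\<^sup>2 - real q = 0"
    by (rule exists_cubic_root_upper[OF q2])
  obtain G where "\<exists>v\<in>linked_vertices. G v \<noteq> 0"
    "\<And>v. v \<in> linked_vertices \<Longrightarrow> (\<Sum>u | u \<in> linked_vertices \<and> linked v u. G u) = \<mu> * G v"
    by (rule linked_eigenvector[OF \<mu>(3)]) (rule that; assumption)
  then have "eigenvalue (adj_matrix (card linked_vertices) E) \<mu>"
    unfolding eig by blast
  then have "HL_index (card linked_vertices) E < sqrt (real q) - 1"
    using HL(2)[of \<mu>] \<mu>(1,2) by simp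
  with E lower show ?thesis by blast
qed

lemma linked_vertices_card_ge: "N \<le> card linked_vertices"
  using card_P by (simp add: linked_vertices_def card_cartesian_product)

end

end

theorem theorem4p2:
  fixes k :: nat
  assumes "k \<ge> 1" and "prime_power (k - 1)"
  shows "\<forall>N. \<exists>n > N. \<exists>E. simple_graph n E \<and> connected_graph n E \<and> bipartite_graph n E
           \<and> regular_graph n E k
           \<and> sqrt (real k - 2) - 1 < HL_index n E \<and> HL_index n E < sqrt (real k - 1) - 1"
proof
  fix M :: nat
  define q where "q = k - 1"
  have k: "k = q + 1" "real k - 1 = real q" "real k - 2 = real q - 1"
    using assms(1) by (auto simp: q_def)
  obtain P :: "complex plane_point set" and I \<omega> where "polar_plane P I \<omega> q"
    using exists_polar_plane assms(2) unfolding q_def by blast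
  then interpret polar_plane P I \<omega> q .
  \<comment> \<open>The number of copies is even for the alternating signs and exceeds the
    prescribed bound \<open>M\<close>.\<close>
  have N: "even (2 * Suc M)" "2 * Suc M > 0" by simp_all
  have "card (linked_vertices (2 * Suc M)) > M"
    using linked_vertices_card_ge[OF N] by simp
  then show "\<exists>n > M. \<exists>E. simple_graph n E \<and> connected_graph n E \<and> bipartite_graph n E
           \<and> regular_graph n E k
           \<and> sqrt (real k - 2) - 1 < HL_index n E \<and> HL_index n E < sqrt (real k - 1) - 1"
    unfolding k(2,3) using linked_graph[OF N] k(1) by blast
qed

end
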